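(* Let $V$, $V_1$ be real-valued functions of compact support belonging to $L^\infty(\mathbb{R})$, and let $(V_\lambda)_{\lambda>0}$ be a family of real-valued bounded functions of compact support such that the supports of $V_\lambda$ lie in one common bounded interval for all sufficiently small $\lambda>0$ and $\|V_\lambda-V-\lambda V_1\|_{L_2(\mathbb{R})}=o(\lambda)$ as $\lambda\to0^+$. If $$\int_{\mathbb{R}}V\,dx<0,$$ then, for all small $\lambda>0$, the operator $H_\lambda=-\frac{d^2}{dx^2}+\lambda V_\lambda$ has a negative eigenvalue $e_\lambda$ of the form $$e_\lambda=-\lambda^2(\omega_0+\lambda\omega_1+o(\lambda))^2$$ as $\lambda\to0^+$, where $$\omega_0=\frac12\int_{\mathbb{R}}V\,dx,\qquad \omega_1=\frac14\iint_{\mathbb{R}^2}V(x)\,|x-y|\,V(y)\,dx\,dy+\frac12\int_{\mathbb{R}}V_1\,dx.$$ In the case $V_\lambda=V$ for all $\lambda$, this asymptotic formula coincides with $$\sqrt{-e_\lambda}=-\frac{\lambda}{2}\int_{\mathbb{R}}V(x)\,dx-\frac{\lambda^2}{4}\iint_{\mathbb{R}^2}V(x)\,|x-y|\,V(y)\,dx\,dy+o(\lambda^2)\quad\text{as }\lambda\to0^+.$$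
   Context: The operator $H_\lambda=-\frac{d^2}{dx^2}+\lambda V_\lambda$ acts in $L_2(\mathbb{R})$ with domain $W_2^2(\mathbb{R})$ (the Sobolev space), for $\lambda>0$. *)

theory Defs
  imports "HOL-Analysis.Analysis" "HOL-Library.Landau_Symbols"
begin

section \<open>Function spaces on the real line\<close>

text \<open>
  Elements of the Lebesgue spaces are represented by Lebesgue measurable functions; all notions
  below are invariant under changes on null sets. The Hilbert space consists of complex-valued
  functions, the potentials are real-valued.
\<close>

definition L2 :: "(real \<Rightarrow> complex) set" where
  "L2 = {u. u \<in> borel_measurable lebesgue \<and> integrable lebesgue (\<lambda>x. (cmod (u x))\<^sup>2)}"

definition Linf :: "(real \<Rightarrow> real) set" where
  "Linf = {f. f \<in> borel_measurable lebesgue \<and> (\<exists>C. AE x in lebesgue. \<bar>f x\<bar> \<le> C)}"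

text \<open>Meaningful only if \<open>f\<close> is square integrable; otherwise the library integral returns 0.\<close>

definition L2_norm_real :: "(real \<Rightarrow> real) \<Rightarrow> real" where
  "L2_norm_real f = sqrt (LINT x|lebesgue. (f x)\<^sup>2)"

text \<open>
  The support of an equivalence class of functions: the complement of the largest open set on
  which \<open>f\<close> vanishes almost everywhere. It is contained in the closure of \<open>{x. f x \<noteq> 0}\<close>.
\<close>

definition ess_support :: "(real \<Rightarrow> real) \<Rightarrow> real set" where
  "ess_support f = - \<Union>{U. open U \<and> (AE x in lebesgue. x \<in> U \<longrightarrow> f x = 0)}"

definition test_function :: "(real \<Rightarrow> real) \<Rightarrow> bool" where
  "test_function \<phi> \<longleftrightarrow>
     (\<forall>n x. (deriv ^^ n) \<phi> field_differentiable at x) \<and> compact (closure {x. \<phi> x \<noteq> 0})"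

text \<open>
  Used below only for functions in \<^term>\<open>L2\<close>, which are locally integrable, so that both
  integrals exist.
\<close>

definition has_weak_deriv :: "(real \<Rightarrow> complex) \<Rightarrow> (real \<Rightarrow> complex) \<Rightarrow> bool" where
  "has_weak_deriv u v \<longleftrightarrow>
     (\<forall>\<phi>. test_function \<phi> \<longrightarrow>
        (LINT x|lebesgue. u x * complex_of_real (deriv \<phi> x)) =
        - (LINT x|lebesgue. v x * complex_of_real (\<phi> x)))"

text \<open>The Sobolev space \<open>W\<^sub>2\<^sup>2(\<real>)\<close>.\<close>

definition sobolev22 :: "(real \<Rightarrow> complex) set" where
  "sobolev22 = {u \<in> L2. \<exists>v\<in>L2. \<exists>w\<in>L2. has_weak_deriv u v \<and> has_weak_deriv v w}"

section \<open>The operator and its eigenvalues\<close>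

text \<open>
  An operator in \<^term>\<open>L2\<close> is represented by its graph. Since weak derivatives are determined
  only almost everywhere, the graph is single-valued up to equality almost everywhere. The
  following is the operator \<open>- d\<^sup>2/dx\<^sup>2 + q\<close> with domain \<^term>\<open>sobolev22\<close>.
\<close>

definition schroedinger :: "(real \<Rightarrow> real) \<Rightarrow> ((real \<Rightarrow> complex) \<times> (real \<Rightarrow> complex)) set" where
  "schroedinger q =
     {(u, f). u \<in> sobolev22 \<and> f \<in> L2 \<and>
        (\<exists>v\<in>L2. \<exists>w\<in>L2. has_weak_deriv u v \<and> has_weak_deriv v w \<and>
           (AE x in lebesgue. f x = - w x + complex_of_real (q x) * u x))}"

definition eigenvalue :: "((real \<Rightarrow> complex) \<times> (real \<Rightarrow> complex)) set \<Rightarrow> complex \<Rightarrow> bool" where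
  "eigenvalue T \<mu> \<longleftrightarrow>
     (\<exists>(u, f)\<in>T. \<not> (AE x in lebesgue. u x = 0) \<and> (AE x in lebesgue. f x = \<mu> * u x))"

section \<open>The coefficients and the two forms of the asymptotics\<close>

text \<open>The integral over the plane uses two-dimensional Lebesgue measure.\<close>

definition double_int :: "(real \<Rightarrow> real) \<Rightarrow> real" where
  "double_int V =
     (LINT (x, y)|(lebesgue :: (real \<times> real) measure). V x * \<bar>x - y\<bar> * V y)"

definition omega0 :: "(real \<Rightarrow> real) \<Rightarrow> real" where
  "omega0 V = 1/2 * (LINT x|lebesgue. V x)"

definition omega1 :: "(real \<Rightarrow> real) \<Rightarrow> (real \<Rightarrow> real) \<Rightarrow> real" where
  "omega1 V V1 = 1/4 * double_int V + 1/2 * (LINT x|lebesgue. V1 x)"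

definition eigenvalue_asymp ::
    "(real \<Rightarrow> real) \<Rightarrow> (real \<Rightarrow> real) \<Rightarrow> (real \<Rightarrow> real) \<Rightarrow> bool" where
  "eigenvalue_asymp V V1 e \<longleftrightarrow>
     (\<exists>r. r \<in> o[at_right 0](\<lambda>l. l) \<and>
        (\<forall>\<^sub>F l in at_right 0. e l = - l\<^sup>2 * (omega0 V + l * omega1 V V1 + r l)\<^sup>2))"

definition sqrt_asymp :: "(real \<Rightarrow> real) \<Rightarrow> (real \<Rightarrow> real) \<Rightarrow> bool" where
  "sqrt_asymp V e \<longleftrightarrow>
     (\<exists>r. r \<in> o[at_right 0](\<lambda>l. l\<^sup>2) \<and>
        (\<forall>\<^sub>F l in at_right 0.
           sqrt (- e l) = - (l / 2) * (LINT x|lebesgue. V x) - l\<^sup>2 / 4 * double_int V + r l))"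

end

theory Submission
  imports Defs
begin

text \<open>
  Write \<open>W\<close> for the potential that belongs to the coupling constant \<open>l\<close>. The eigenvalue is sought in
  the form \<open>- k\<^sup>2\<close> with \<open>k > 0\<close>. Then \<open>- u'' + l * W * u = - k\<^sup>2 * u\<close> is
  equivalent to \<open>u = - l * G (W * u)\<close>, where \<open>G\<close> has the kernel \<open>exp (- k * \<bar>x - y\<bar>) / (2 * k)\<close>. As
  \<open>k\<close> tends to \<open>0\<close> the kernel blows up, but only by a constant: it equals \<open>1 / (2 * k) - m\<close>, where
  \<open>m = (1 - exp (- k * \<bar>x - y\<bar>)) / (2 * k)\<close> stays between \<open>0\<close> and its limit \<open>\<bar>x - y\<bar> / 2\<close>. If \<open>u\<close> is normalised
  so that the constant part of the kernel contributes exactly \<open>1\<close>, the equation splits into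
  \<open>u(x) = 1 + l * (\<integral> m(x, y) * W(y) * u(y) dy)\<close> and \<open>k = - (l / 2) * (\<integral> W(y) * u(y) dy)\<close>.
  For small \<open>l\<close> the first equation says that \<open>u\<close> is close to \<open>1\<close> on the interval carrying \<open>W\<close>, and
  then the second one gives \<open>k > 0\<close> because the integral of \<open>W\<close> is negative. Substituting
  \<open>k\<close> into the first equation leaves one fixed point equation for \<open>u\<close>, which is solved by contraction
  (\<open>bound_state_equation\<close>).

  Every solution has the asserted asymptotics (\<open>bound_state_expansion\<close>): inserting the first equation
  once into the second one,
  \<open>k / l = - (1 / 2) * (\<integral> W(x) dx) - (l / 2) * (\<integral> W(x) * (\<integral> m(x, y) * W(y) * u(y) dy) dx)\<close>,
  and in the limit \<open>W\<close> becomes \<open>V + l * V1\<close> in the first integral, while in the second one \<open>W\<close>, \<open>m\<close> and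
  \<open>u\<close> become \<open>V\<close>, \<open>\<bar>x - y\<bar> / 2\<close> and \<open>1\<close>. Thus \<open>k / l = - (\<omega>0 + l * \<omega>1 + o(l))\<close>. All these estimates use
  only \<open>L\<^sup>1\<close> norms of the potentials, and on a bounded interval convergence in \<open>L\<^sup>2\<close> implies convergence
  in \<open>L\<^sup>1\<close>.

  A solution \<open>u\<close> is a genuine eigenfunction (\<open>bound_state_eigenvalue\<close>): convolution with the kernel of
  \<open>G\<close> decays exponentially and, by Fubini and integration by parts against test functions, has the weak
  derivatives demanded by the Sobolev space. The last part of the statement is elementary: a
  constant family forces \<open>V1 = 0\<close> (\<open>constant_family_correction_vanishes\<close>), and the two forms of the
  asymptotics are related by taking square roots (\<open>square_root_expansion_iff\<close>).
\<close>

section \<open>Potentials carried by a bounded interval\<close>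

text \<open>
  These are honest functions, bounded and vanishing everywhere outside the interval rather than
  almost everywhere. Any product with a Borel function that is bounded on the interval is then again
  of this kind, so that integrability is immediate for most integrands below.
\<close>

definition potential_on :: "real \<Rightarrow> (real \<Rightarrow> real) \<Rightarrow> bool" where
  "potential_on R f \<longleftrightarrow> f \<in> borel_measurable borel \<and> (\<exists>C. \<forall>x. \<bar>f x\<bar> \<le> C) \<and> (\<forall>x. R < \<bar>x\<bar> \<longrightarrow> f x = 0)"

lemma potential_on_measurable: "potential_on R f \<Longrightarrow> f \<in> borel_measurable borel"
  and potential_on_outside: "potential_on R f \<Longrightarrow> R < \<bar>x\<bar> \<Longrightarrow> f x = 0"
  by (auto simp: potential_on_def)

lemma potential_on_bounded:
  assumes "potential_on R f"
  obtains C where "C > 0" "\<And>x. \<bar>f x\<bar> \<le> C"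
proof -
  obtain C where C: "\<And>x. \<bar>f x\<bar> \<le> C"
    using assms by (auto simp: potential_on_def)
  show thesis
    by (rule that[of "max C 1"]) (auto intro: order_trans[OF C])
qed

lemma potential_on_mult:
  assumes f: "potential_on R f" and g: "g \<in> borel_measurable borel"
    and K: "\<And>x. \<bar>x\<bar> \<le> R \<Longrightarrow> \<bar>g x\<bar> \<le> K"
  shows "potential_on R (\<lambda>x. f x * g x)"
proof -
  obtain C where C: "C > 0" "\<And>x. \<bar>f x\<bar> \<le> C"
    using potential_on_bounded[OF f] by blast
  have "\<bar>f x * g x\<bar> \<le> C * \<bar>K\<bar>" for x
  proof (cases "\<bar>x\<bar> \<le> R")
    case True
    then have "\<bar>g x\<bar> \<le> \<bar>K\<bar>" using K[of x] by linarith
    then show ?thesis using C by (simp add: abs_mult mult_mono)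
  next
    case False
    then show ?thesis using potential_on_outside[OF f, of x] C by simp
  qed
  then show ?thesis
    using f g by (auto simp: potential_on_def)
qed

lemma potential_on_integrable:
  assumes "potential_on R f"
  shows "integrable lborel f"
proof -
  obtain C where C: "C > 0" "\<And>x. \<bar>f x\<bar> \<le> C"
    using potential_on_bounded[OF assms] by blast
  have "integrable lborel (\<lambda>x. indicator {-R..R} x * C)"
    by (intro integrable_mult_left integrable_real_indicator) (auto simp: emeasure_lborel_Icc_eq)
  then show ?thesis
  proof (rule Bochner_Integration.integrable_bound)
    show "f \<in> borel_measurable lborel"
      using potential_on_measurable[OF assms] by simp
    show "AE x in lborel. norm (f x) \<le> norm (indicator {- R..R} x * C)"
      using C potential_on_outside[OF assms] by (auto simp: indicator_def abs_le_iff)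
  qed
qed

lemma potential_on_diff: "potential_on R f \<Longrightarrow> potential_on R g \<Longrightarrow> potential_on R (\<lambda>x. f x - g x)"
proof -
  assume f: "potential_on R f" and g: "potential_on R g"
  obtain C where C: "\<And>x. \<bar>f x\<bar> \<le> C"
    using potential_on_bounded[OF f] by blast
  obtain D where D: "\<And>x. \<bar>g x\<bar> \<le> D"
    using potential_on_bounded[OF g] by blast
  have "\<bar>f x - g x\<bar> \<le> C + D" for x
    using C[of x] D[of x] by linarith
  then show ?thesis
    using f g by (auto simp: potential_on_def)
qed

lemma potential_on_abs: "potential_on R f \<Longrightarrow> potential_on R (\<lambda>x. \<bar>f x\<bar>)"
  by (auto simp: potential_on_def)

lemma potential_on_scale: "potential_on R f \<Longrightarrow> potential_on R (\<lambda>x. c * f x)"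
  using potential_on_mult[of R f "\<lambda>_. c" "\<bar>c\<bar>"] by (simp add: mult.commute)

lemma potential_integral_bound:
  assumes f: "potential_on R f" and g: "g \<in> borel_measurable borel"
    and K: "\<And>x. \<bar>x\<bar> \<le> R \<Longrightarrow> \<bar>g x\<bar> \<le> K"
  shows "\<bar>LINT x|lborel. f x * g x\<bar> \<le> K * (LINT x|lborel. \<bar>f x\<bar>)"
proof -
  have int: "integrable lborel (\<lambda>x. f x * g x)"
    using potential_on_integrable[OF potential_on_mult[OF assms]] .
  have "\<bar>LINT x|lborel. f x * g x\<bar> \<le> (LINT x|lborel. \<bar>f x * g x\<bar>)"
    using integral_norm_bound[of lborel "\<lambda>x. f x * g x"] by simp
  also have "\<dots> \<le> (LINT x|lborel. K * \<bar>f x\<bar>)"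
  proof (rule integral_mono)
    show "integrable lborel (\<lambda>x. \<bar>f x * g x\<bar>)" using int by simp
    show "integrable lborel (\<lambda>x. K * \<bar>f x\<bar>)"
      using potential_on_integrable[OF f] by simp
    show "\<bar>f x * g x\<bar> \<le> K * \<bar>f x\<bar>" for x
    proof (cases "\<bar>x\<bar> \<le> R")
      case True
      then show ?thesis using K[of x] by (simp add: abs_mult mult.commute[of "\<bar>f x\<bar>"] mult_right_mono)
    next
      case False
      then show ?thesis using potential_on_outside[OF f, of x] by simp
    qed
  qed
  finally show ?thesis by simp
qed

section \<open>The regular part of the resolvent kernel\<close>

text \<open>
  This is what is left of the kernel \<open>exp (- k * \<bar>t\<bar>) / (2 * k)\<close> of the inverse of \<open>- d\<^sup>2/dx\<^sup>2 + k\<^sup>2\<close>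
  after its singular constant \<open>1 / (2 * k)\<close> is split off and the sign is changed; the argument \<open>s\<close>
  stands for \<open>\<bar>t\<bar>\<close>. The value at \<open>k = 0\<close> is the limit, so that the derivative in \<open>s\<close> is
  \<open>exp (- k * s) / 2\<close> without exception.
\<close>

definition regular_part :: "real \<Rightarrow> real \<Rightarrow> real" where
  "regular_part k s = (if k = 0 then s / 2 else (1 - exp (- k * s)) / (2 * k))"

lemma regular_part_zero [simp]: "regular_part 0 s = s / 2" "regular_part k 0 = 0"
  by (simp_all add: regular_part_def)

lemma DERIV_regular_part: "(regular_part k has_real_derivative exp (- k * s) / 2) (at s)"
proof (cases "k = 0")
  case True
  then have "regular_part k = (\<lambda>s. s / 2)" by (auto simp: regular_part_def)
  then show ?thesis using True by (auto intro!: derivative_eq_intros)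
next
  case False
  then have "regular_part k = (\<lambda>s. (1 - exp (- k * s)) / (2 * k))" by (auto simp: regular_part_def)
  then show ?thesis using False by (auto intro!: derivative_eq_intros)
qed

lemma regular_part_measurable [measurable]: "regular_part k \<in> borel_measurable borel"
  by (intro borel_measurable_continuous_onI continuous_at_imp_continuous_on ballI DERIV_isCont[OF DERIV_regular_part])

text \<open>
  Both functions vanish at \<open>s = 0\<close>, so it suffices to compare derivatives in \<open>s\<close>: that of the
  difference is \<open>(exp (- k * s) - exp (- k' * s)) / 2\<close>, which lies between \<open>0\<close> and
  \<open>(k' - k) * s / 2\<close>. The case \<open>k = 0\<close> measures how fast the kernel approaches \<open>s / 2\<close>.
\<close>

lemma regular_part_antimono_wavenumber:
  assumes "0 \<le> k" "k \<le> k'" "0 \<le> s"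
  shows "0 \<le> regular_part k s - regular_part k' s" "regular_part k s - regular_part k' s \<le> (k' - k) * s\<^sup>2 / 4"
proof -
  have d: "((\<lambda>s. regular_part k s - regular_part k' s) has_real_derivative (exp (- k * s) - exp (- k' * s)) / 2) (at s)" for s
    using DERIV_diff[OF DERIV_regular_part DERIV_regular_part] by (simp add: diff_divide_distrib)
  have pos: "exp (- k * s) - exp (- k' * s) \<ge> 0" if "s \<ge> 0" for s :: real
    using assms that by (simp add: mult_right_mono)
  have up: "exp (- k * s) - exp (- k' * s) \<le> (k' - k) * s" if "s \<ge> 0" for s :: real
  proof -
    have "exp (- k * s) - exp (- k' * s) = exp (- k * s) * (1 - exp (- ((k' - k) * s)))"
      by (simp add: algebra_simps exp_add[symmetric])
    also have "\<dots> \<le> 1 * ((k' - k) * s)"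
      using exp_ge_add_one_self[of "- ((k' - k) * s)"] assms that
      by (intro mult_mono) auto
    finally show ?thesis by simp
  qed
  have "regular_part k 0 - regular_part k' 0 \<le> regular_part k s - regular_part k' s"
    by (rule DERIV_nonneg_imp_nondecreasing[OF assms(3)]) (use d pos in force)
  then show "0 \<le> regular_part k s - regular_part k' s" by simp
  have d2: "((\<lambda>s. (k' - k) * s\<^sup>2 / 4 - (regular_part k s - regular_part k' s)) has_real_derivative
      ((k' - k) * s - (exp (- k * s) - exp (- k' * s))) / 2) (at s)" for s
    by (rule DERIV_cong[OF DERIV_diff[OF _ d]]) (auto intro!: derivative_eq_intros simp: field_simps)
  have "(k' - k) * 0\<^sup>2 / 4 - (regular_part k 0 - regular_part k' 0) \<le> (k' - k) * s\<^sup>2 / 4 - (regular_part k s - regular_part k' s)"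
    by (rule DERIV_nonneg_imp_nondecreasing[OF assms(3)]) (use d2 up in force)
  then show "regular_part k s - regular_part k' s \<le> (k' - k) * s\<^sup>2 / 4" by simp
qed

lemma regular_part_lipschitz_wavenumber:
  assumes "0 \<le> k" "0 \<le> k'" "0 \<le> s"
  shows "\<bar>regular_part k s - regular_part k' s\<bar> \<le> \<bar>k - k'\<bar> * s\<^sup>2 / 4"
  using regular_part_antimono_wavenumber[of k k' s] regular_part_antimono_wavenumber[of k' k s] assms
  by (cases "k \<le> k'") (auto simp: abs_if)

lemma regular_part_lipschitz:
  assumes "0 \<le> k" "0 \<le> s" "0 \<le> t"
  shows "\<bar>regular_part k s - regular_part k t\<bar> \<le> \<bar>s - t\<bar> / 2"
proof -
  have *: "0 \<le> regular_part k t - regular_part k s \<and> regular_part k t - regular_part k s \<le> (t - s) / 2" if "0 \<le> s" "s \<le> t" for s t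
  proof
    have "regular_part k s \<le> regular_part k t"
      by (rule DERIV_nonneg_imp_nondecreasing[OF that(2)]) (use DERIV_regular_part in force)
    then show "0 \<le> regular_part k t - regular_part k s" by simp
    have d: "((\<lambda>s. s / 2 - regular_part k s) has_real_derivative (1 - exp (- k * x)) / 2) (at x)" for x
      by (rule DERIV_cong[OF DERIV_diff[OF _ DERIV_regular_part]]) (auto intro!: derivative_eq_intros simp: field_simps)
    have "s / 2 - regular_part k s \<le> t / 2 - regular_part k t"
      by (rule DERIV_nonneg_imp_nondecreasing[OF that(2)]) (use d assms(1) that(1) in force)
    then show "regular_part k t - regular_part k s \<le> (t - s) / 2" by argo
  qed
  show ?thesis
    using *[of s t] *[of t s] assms by (cases "s \<le> t") auto
qed

lemma regular_part_bounds:
  assumes "0 \<le> k" "0 \<le> s"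
  shows "\<bar>regular_part k s\<bar> \<le> s / 2"
  using regular_part_lipschitz[of k s 0] assms by simp

lemma regular_part_bound_on_interval:
  assumes "0 \<le> k" "\<bar>x\<bar> \<le> R" "\<bar>y\<bar> \<le> R"
  shows "\<bar>regular_part k \<bar>x - y\<bar>\<bar> \<le> R"
proof -
  have "\<bar>x - y\<bar> \<le> 2 * R" using assms(2,3) by linarith
  then show ?thesis using regular_part_bounds[OF assms(1), of "\<bar>x - y\<bar>"] by simp
qed

lemma sq_dist_le:
  assumes "\<bar>x\<bar> \<le> R" "\<bar>y\<bar> \<le> (R::real)"
  shows "\<bar>x - y\<bar>\<^sup>2 \<le> 4 * R\<^sup>2"
  using power_mono[of "\<bar>x - y\<bar>" "2 * R" 2] assms by (simp add: power_mult_distrib)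

lemma regular_part_diff_on_interval:
  assumes "0 \<le> k" "0 \<le> k'" "\<bar>x\<bar> \<le> R" "\<bar>y\<bar> \<le> R"
  shows "\<bar>regular_part k \<bar>x - y\<bar> - regular_part k' \<bar>x - y\<bar>\<bar> \<le> \<bar>k - k'\<bar> * R\<^sup>2"
proof -
  have "\<bar>k - k'\<bar> * \<bar>x - y\<bar>\<^sup>2 \<le> \<bar>k - k'\<bar> * (4 * R\<^sup>2)"
    using sq_dist_le[OF assms(3,4)] by (intro mult_left_mono) auto
  then show ?thesis
    using regular_part_lipschitz_wavenumber[of k k' "\<bar>x - y\<bar>"] assms by simp
qed

section \<open>The integral operator with the regular kernel\<close>

definition regular_op :: "real \<Rightarrow> (real \<Rightarrow> real) \<Rightarrow> (real \<Rightarrow> real) \<Rightarrow> real \<Rightarrow> real" where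
  "regular_op k W u x = (LINT y|lborel. W y * (regular_part k \<bar>x - y\<bar> * u y))"

lemma regular_part_kernel_mult:
  assumes "0 \<le> k" "u \<in> borel_measurable borel" "\<And>y. \<bar>y\<bar> \<le> R \<Longrightarrow> \<bar>u y\<bar> \<le> K"
    and x: "\<bar>x\<bar> \<le> R" and R: "0 \<le> R"
  shows "(\<lambda>y. regular_part k \<bar>x - y\<bar> * u y) \<in> borel_measurable borel"
    "\<And>y. \<bar>y\<bar> \<le> R \<Longrightarrow> \<bar>regular_part k \<bar>x - y\<bar> * u y\<bar> \<le> R * K"
proof -
  note [measurable] = assms(2)
  show "(\<lambda>y. regular_part k \<bar>x - y\<bar> * u y) \<in> borel_measurable borel" by measurable
  show "\<bar>regular_part k \<bar>x - y\<bar> * u y\<bar> \<le> R * K" if "\<bar>y\<bar> \<le> R" for y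
    using regular_part_bound_on_interval[OF assms(1) x that] assms(3)[OF that] R
    by (simp add: abs_mult mult_mono)
qed

lemma regular_op_integrable:
  assumes "potential_on R W" "0 \<le> k" "u \<in> borel_measurable borel"
    "\<And>y. \<bar>y\<bar> \<le> R \<Longrightarrow> \<bar>u y\<bar> \<le> K" "\<bar>x\<bar> \<le> R" "0 \<le> R"
  shows "integrable lborel (\<lambda>y. W y * (regular_part k \<bar>x - y\<bar> * u y))"
  by (rule potential_on_integrable[OF potential_on_mult[OF assms(1) regular_part_kernel_mult[OF assms(2-6)]]])

lemma regular_op_bound:
  assumes "potential_on R W" "0 \<le> k" "u \<in> borel_measurable borel"
    "\<And>y. \<bar>y\<bar> \<le> R \<Longrightarrow> \<bar>u y\<bar> \<le> K" "\<bar>x\<bar> \<le> R" "0 \<le> R"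
  shows "\<bar>regular_op k W u x\<bar> \<le> R * K * (LINT x|lborel. \<bar>W x\<bar>)"
  unfolding regular_op_def
  by (rule potential_integral_bound[OF assms(1) regular_part_kernel_mult[OF assms(2-6)]])

text \<open>
  Serves twice: for the contraction, where function and wave number change together, and for the
  expansion, where \<open>w\<close> and \<open>k\<close> are replaced by \<open>1\<close> and \<open>0\<close>.
\<close>

lemma regular_op_diff:
  assumes W: "potential_on R W" and k: "0 \<le> k" "0 \<le> k'"
    and u: "u \<in> borel_measurable borel" "\<And>y. \<bar>y\<bar> \<le> R \<Longrightarrow> \<bar>u y\<bar> \<le> K"
    and u': "u' \<in> borel_measurable borel" "\<And>y. \<bar>y\<bar> \<le> R \<Longrightarrow> \<bar>u' y\<bar> \<le> K'"
    and d: "\<And>y. \<bar>y\<bar> \<le> R \<Longrightarrow> \<bar>u y - u' y\<bar> \<le> d" and x: "\<bar>x\<bar> \<le> R" and R: "0 \<le> R"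
  shows "\<bar>regular_op k W u x - regular_op k' W u' x\<bar>
    \<le> (\<bar>k - k'\<bar> * R\<^sup>2 * K + R * d) * (LINT x|lborel. \<bar>W x\<bar>)"
proof -
  note [measurable] = u(1) u'(1)
  have "regular_op k W u x - regular_op k' W u' x =
      (LINT y|lborel. W y * (regular_part k \<bar>x - y\<bar> * u y - regular_part k' \<bar>x - y\<bar> * u' y))"
    unfolding regular_op_def
    by (subst Bochner_Integration.integral_diff[symmetric])
      (use regular_op_integrable[OF W k(1) u x R] regular_op_integrable[OF W k(2) u' x R]
        in \<open>auto simp: right_diff_distrib\<close>)
  also have "\<bar>\<dots>\<bar> \<le> (\<bar>k - k'\<bar> * R\<^sup>2 * K + R * d) * (LINT x|lborel. \<bar>W x\<bar>)"
  proof (rule potential_integral_bound[OF W])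
    show "(\<lambda>y. regular_part k \<bar>x - y\<bar> * u y - regular_part k' \<bar>x - y\<bar> * u' y) \<in> borel_measurable borel"
      by measurable
    fix y assume y: "\<bar>y\<bar> \<le> R"
    have "regular_part k \<bar>x - y\<bar> * u y - regular_part k' \<bar>x - y\<bar> * u' y =
      (regular_part k \<bar>x - y\<bar> - regular_part k' \<bar>x - y\<bar>) * u y + regular_part k' \<bar>x - y\<bar> * (u y - u' y)"
      by (simp add: algebra_simps)
    also have "\<bar>\<dots>\<bar> \<le> \<bar>regular_part k \<bar>x - y\<bar> - regular_part k' \<bar>x - y\<bar>\<bar> * \<bar>u y\<bar> + \<bar>regular_part k' \<bar>x - y\<bar>\<bar> * \<bar>u y - u' y\<bar>"
      by (rule order_trans[OF abs_triangle_ineq]) (simp add: abs_mult)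
    also have "\<dots> \<le> \<bar>k - k'\<bar> * R\<^sup>2 * K + R * d"
      using regular_part_diff_on_interval[OF k x y] regular_part_bound_on_interval[OF k(2) x y] u(2)[OF y] d[OF y] R
      by (intro add_mono mult_mono) auto
    finally show "\<bar>regular_part k \<bar>x - y\<bar> * u y - regular_part k' \<bar>x - y\<bar> * u' y\<bar> \<le> \<bar>k - k'\<bar> * R\<^sup>2 * K + R * d" .
  qed
  finally show ?thesis .
qed

lemma regular_op_lipschitz:
  assumes W: "potential_on R W" and k: "0 \<le> k"
    and u: "u \<in> borel_measurable borel" "\<And>y. \<bar>y\<bar> \<le> R \<Longrightarrow> \<bar>u y\<bar> \<le> K"
    and x: "\<bar>x\<bar> \<le> R" "\<bar>x'\<bar> \<le> R" and R: "0 \<le> R"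
  shows "\<bar>regular_op k W u x - regular_op k W u x'\<bar> \<le> K * (LINT x|lborel. \<bar>W x\<bar>) * \<bar>x - x'\<bar>"
proof -
  note [measurable] = u(1)
  have "regular_op k W u x - regular_op k W u x' =
      (LINT y|lborel. W y * ((regular_part k \<bar>x - y\<bar> - regular_part k \<bar>x' - y\<bar>) * u y))"
    unfolding regular_op_def
    by (subst Bochner_Integration.integral_diff[symmetric])
      (use regular_op_integrable[OF W k u] x R in \<open>auto simp: algebra_simps\<close>)
  also have "\<bar>\<dots>\<bar> \<le> (\<bar>x - x'\<bar> * K) * (LINT x|lborel. \<bar>W x\<bar>)"
  proof (rule potential_integral_bound[OF W])
    show "(\<lambda>y. (regular_part k \<bar>x - y\<bar> - regular_part k \<bar>x' - y\<bar>) * u y) \<in> borel_measurable borel"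
      by measurable
    fix y assume y: "\<bar>y\<bar> \<le> R"
    have "\<bar>regular_part k \<bar>x - y\<bar> - regular_part k \<bar>x' - y\<bar>\<bar> \<le> \<bar>\<bar>x - y\<bar> - \<bar>x' - y\<bar>\<bar> / 2"
      by (rule regular_part_lipschitz[OF k abs_ge_zero abs_ge_zero])
    also have "\<dots> \<le> \<bar>(x - y) - (x' - y)\<bar> / 2"
      by (rule divide_right_mono[OF abs_triangle_ineq3]) simp
    also have "\<dots> \<le> \<bar>x - x'\<bar>" by simp
    finally have "\<bar>regular_part k \<bar>x - y\<bar> - regular_part k \<bar>x' - y\<bar>\<bar> \<le> \<bar>x - x'\<bar>" .
    then show "\<bar>(regular_part k \<bar>x - y\<bar> - regular_part k \<bar>x' - y\<bar>) * u y\<bar> \<le> \<bar>x - x'\<bar> * K"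
      using u(2)[OF y] by (simp add: abs_mult mult_mono)
  qed
  finally show ?thesis by (simp add: mult_ac)
qed

section \<open>The bound state equation\<close>

text \<open>
  The two unknowns \<open>w\<close> and \<open>k\<close> are reduced to one by regarding \<open>k\<close> as a functional of \<open>w\<close>; then \<open>w\<close>
  is a fixed point of a single map. On the ball of radius \<open>\<delta> = 2 * l * R * M\<close> around the constant
  \<open>1\<close> the functional is positive because the integral of \<open>W\<close> is negative and the deviation of \<open>w\<close> from \<open>1\<close> changes that
  integral by at most \<open>\<delta> * M \<le> c\<close>. Since \<open>k\<close> is Lipschitz in \<open>w\<close> and the kernel is Lipschitz in \<open>k\<close>,
  the map contracts for \<open>\<delta> \<le> 1\<close>.
\<close>

theorem bound_state_equation:
  assumes R: "0 < R" and W: "potential_on R W" and M: "0 < M" "(LINT x|lborel. \<bar>W x\<bar>) \<le> M"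
    and c: "0 < c" "(LINT x|lborel. W x) \<le> - 2 * c"
    and l: "0 < l" "2 * l * R * M \<le> 1" "2 * l * R * M\<^sup>2 \<le> c"
  obtains w k where "w \<in> borel_measurable borel" "\<And>x. \<bar>w x - 1\<bar> \<le> 2 * l * R * M"
    "0 < k" "k \<le> l * M" "k = - (l / 2) * (LINT x|lborel. W x * w x)"
    "\<And>x. \<bar>x\<bar> \<le> R \<Longrightarrow> w x = 1 + l * regular_op k W w x"
proof -
  define \<delta> where "\<delta> = 2 * l * R * M"
  have \<delta>: "0 < \<delta>" "\<delta> \<le> 1" "\<delta> * M \<le> c"
    using assms by (auto simp: \<delta>_def power2_eq_square mult_ac)
  define S :: "(real \<Rightarrow>\<^sub>C real) set" where "S = cball (const_bcontfun 1) \<delta>"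
  define kk where "kk u = - (l / 2) * (LINT x|lborel. W x * u x)" for u :: "real \<Rightarrow> real"
  \<comment> \<open>Only values on the interval matter. Composing with the retraction onto it turns functions on
  the interval into bounded continuous functions on the line, where completeness is available.\<close>
  define cl where "cl x = max (- R) (min R x)" for x :: real
  have cl: "\<bar>cl x\<bar> \<le> R" "\<bar>cl x - cl y\<bar> \<le> \<bar>x - y\<bar>" for x y
    using R by (auto simp: cl_def)
  have cl_id: "cl x = x" if "\<bar>x\<bar> \<le> R" for x
    using that by (auto simp: cl_def)
  define TT where "TT u x = 1 + l * regular_op (kk u) W u (cl x)" for u :: "real \<Rightarrow> real" and x
  define T where "T u = Bcontfun (TT (apply_bcontfun u))" for u :: "real \<Rightarrow>\<^sub>C real"
  have meas: "apply_bcontfun u \<in> borel_measurable borel" for u :: "real \<Rightarrow>\<^sub>C real"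
    by (intro borel_measurable_continuous_onI) simp
  have close: "\<bar>u x - 1\<bar> \<le> \<delta>" if "u \<in> S" for u x
    using dist_bounded[of "const_bcontfun 1" x u] that
    by (simp add: S_def dist_real_def abs_minus_commute)
  have le2: "\<bar>u x\<bar> \<le> 2" if "u \<in> S" for u x
    using close[OF that, of x] \<delta> by linarith
  have intW: "integrable lborel W" using potential_on_integrable[OF W] .
  have intWu: "integrable lborel (\<lambda>x. W x * u x)" if "u \<in> S" for u
    using potential_on_mult[OF W meas le2[OF that]] by (rule potential_on_integrable)
  have kk_bounds: "0 < kk u" "kk u \<le> l * M" if "u \<in> S" for u
  proof -
    have "(LINT x|lborel. W x * u x) - (LINT x|lborel. W x) = (LINT x|lborel. W x * (u x - 1))"
      using intW intWu[OF that]
      by (subst Bochner_Integration.integral_diff[symmetric]) (auto simp: algebra_simps)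
    also have "\<bar>\<dots>\<bar> \<le> \<delta> * (LINT x|lborel. \<bar>W x\<bar>)"
      using close[OF that] meas by (intro potential_integral_bound[OF W]) auto
    also have "\<dots> \<le> \<delta> * M" using M \<delta> by simp
    finally have "(LINT x|lborel. W x * u x) < 0"
      using c \<delta> by linarith
    then show "0 < kk u" using l by (simp add: kk_def mult_pos_neg)
    have "\<bar>LINT x|lborel. W x * u x\<bar> \<le> 2 * (LINT x|lborel. \<bar>W x\<bar>)"
      using le2[OF that] meas by (intro potential_integral_bound[OF W]) auto
    also have "\<dots> \<le> 2 * M" using M by simp
    finally have "- (LINT x|lborel. W x * u x) \<le> 2 * M" by linarith
    then have "(l / 2) * - (LINT x|lborel. W x * u x) \<le> (l / 2) * (2 * M)"
      using l by (intro mult_left_mono) auto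
    then show "kk u \<le> l * M" by (simp add: kk_def)
  qed
  have kk_lip: "\<bar>kk u - kk v\<bar> \<le> l * M / 2 * dist u v" if "u \<in> S" "v \<in> S" for u v
  proof -
    have "(LINT x|lborel. W x * u x) - (LINT x|lborel. W x * v x) = (LINT x|lborel. W x * (u x - v x))"
      using intWu that
      by (subst Bochner_Integration.integral_diff[symmetric]) (auto simp: algebra_simps)
    also have "\<bar>\<dots>\<bar> \<le> dist u v * (LINT x|lborel. \<bar>W x\<bar>)"
      using dist_bounded[of u _ v] meas
      by (intro potential_integral_bound[OF W]) (auto simp: dist_real_def)
    also have "\<dots> \<le> dist u v * M" using M by (intro mult_left_mono) auto
    finally have "\<bar>(LINT x|lborel. W x * u x) - (LINT x|lborel. W x * v x)\<bar> \<le> dist u v * M" .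
    then have "(l / 2) * \<bar>(LINT x|lborel. W x * u x) - (LINT x|lborel. W x * v x)\<bar> \<le> (l / 2) * (dist u v * M)"
      using l by (intro mult_left_mono) auto
    moreover have "\<bar>kk u - kk v\<bar> = (l / 2) * \<bar>(LINT x|lborel. W x * u x) - (LINT x|lborel. W x * v x)\<bar>"
    proof -
      have "kk u - kk v = - ((l / 2) * ((LINT x|lborel. W x * u x) - (LINT x|lborel. W x * v x)))"
        by (simp add: kk_def algebra_simps)
      then show ?thesis using l by (simp add: abs_mult)
    qed
    ultimately show ?thesis by (simp add: mult_ac)
  qed
  have TT_close: "\<bar>TT u x - 1\<bar> \<le> \<delta>" if "u \<in> S" for u x
  proof -
    have "\<bar>regular_op (kk u) W u (cl x)\<bar> \<le> R * 2 * (LINT x|lborel. \<bar>W x\<bar>)"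
      using kk_bounds[OF that] le2[OF that] meas cl R by (intro regular_op_bound[OF W]) auto
    also have "\<dots> \<le> R * 2 * M" using M R by simp
    finally have "l * \<bar>regular_op (kk u) W u (cl x)\<bar> \<le> l * (R * 2 * M)"
      using l by (intro mult_left_mono) auto
    then show ?thesis using l by (simp add: TT_def \<delta>_def abs_mult mult_ac)
  qed
  have TT_cont: "continuous_on UNIV (TT u)" if "u \<in> S" for u
  proof (rule continuous_onI)
    fix x e :: real assume e: "0 < e"
    have lip: "\<bar>TT u x' - TT u x\<bar> \<le> l * (2 * M) * \<bar>x' - x\<bar>" for x'
    proof -
      have "\<bar>regular_op (kk u) W u (cl x') - regular_op (kk u) W u (cl x)\<bar>
          \<le> 2 * (LINT x|lborel. \<bar>W x\<bar>) * \<bar>cl x' - cl x\<bar>"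
        using kk_bounds[OF that] le2[OF that] meas cl R by (intro regular_op_lipschitz[OF W]) auto
      also have "\<dots> \<le> 2 * M * \<bar>x' - x\<bar>"
        using M cl by (intro mult_mono) auto
      finally have "l * \<bar>regular_op (kk u) W u (cl x') - regular_op (kk u) W u (cl x)\<bar> \<le> l * (2 * M * \<bar>x' - x\<bar>)"
        using l by (intro mult_left_mono) auto
      moreover have "\<bar>TT u x' - TT u x\<bar> = l * \<bar>regular_op (kk u) W u (cl x') - regular_op (kk u) W u (cl x)\<bar>"
        using l by (simp add: TT_def right_diff_distrib[symmetric] abs_mult)
      ultimately show ?thesis by (simp add: mult_ac)
    qed
    have pos: "0 < l * (2 * M)" using l M by simp
    show "\<exists>d>0. \<forall>x'\<in>UNIV. dist x' x < d \<longrightarrow> dist (TT u x') (TT u x) \<le> e"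
    proof (intro exI[of _ "e / (l * (2 * M))"] conjI ballI impI)
      show "0 < e / (l * (2 * M))" using e pos by simp
      fix x' assume "dist x' x < e / (l * (2 * M))"
      then have "l * (2 * M) * \<bar>x' - x\<bar> \<le> e"
        using pos by (simp add: dist_real_def field_simps)
      then show "dist (TT u x') (TT u x) \<le> e"
        using lip[of x'] by (simp add: dist_real_def)
    qed
  qed
  have T_apply: "apply_bcontfun (T u) = TT u" if "u \<in> S" for u
  proof -
    have "TT u \<in> bcontfun"
    proof (rule bcontfun_normI[OF TT_cont[OF that]])
      show "norm (TT u x) \<le> 1 + \<delta>" for x using TT_close[OF that, of x] by (simp add: abs_le_iff)
    qed
    then show ?thesis by (simp add: T_def Bcontfun_inverse)
  qed
  have "\<exists>!u\<in>S. T u = u"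
  proof (rule Banach_fix[of S "3/4" T])
    show "complete S" unfolding S_def by (simp add: complete_eq_closed)
    show "S \<noteq> {}" using \<delta> by (simp add: S_def)
    show "T ` S \<subseteq> S"
    proof
      fix v assume "v \<in> T ` S"
      then obtain u where u: "u \<in> S" "v = T u" by blast
      have "dist (const_bcontfun 1) v \<le> \<delta>"
        by (rule dist_bound) (use TT_close[OF u(1)] in \<open>simp add: u T_apply dist_real_def abs_minus_commute\<close>)
      then show "v \<in> S" by (simp add: S_def)
    qed
    fix u v assume uv: "u \<in> S" "v \<in> S"
    have "dist (T u x) (T v x) \<le> 3 / 4 * dist u v" for x
    proof -
      have "\<bar>regular_op (kk u) W u (cl x) - regular_op (kk v) W v (cl x)\<bar>
        \<le> (\<bar>kk u - kk v\<bar> * R\<^sup>2 * 2 + R * dist u v) * (LINT x|lborel. \<bar>W x\<bar>)"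
        using kk_bounds[OF uv(1)] kk_bounds[OF uv(2)] le2[OF uv(1)] le2[OF uv(2)] meas cl R dist_bounded[of u _ v]
        by (intro regular_op_diff[OF W, where K' = 2]) (auto simp: dist_real_def)
      also have "\<dots> \<le> ((l * M / 2 * dist u v) * R\<^sup>2 * 2 + R * dist u v) * M"
        using kk_lip[OF uv] M R l by (intro mult_mono add_mono mult_right_mono add_nonneg_nonneg mult_nonneg_nonneg) auto
      finally have "l * \<bar>regular_op (kk u) W u (cl x) - regular_op (kk v) W v (cl x)\<bar>
        \<le> l * (((l * M / 2 * dist u v) * R\<^sup>2 * 2 + R * dist u v) * M)"
        using l by (intro mult_left_mono) auto
      \<comment> \<open>The quadratic term comes from the dependence of the wave number on the function.\<close>
      also have "\<dots> = (\<delta>\<^sup>2 / 4 + \<delta> / 2) * dist u v"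
        by (simp add: \<delta>_def power2_eq_square algebra_simps)
      also have "\<dots> \<le> 3 / 4 * dist u v"
        using \<delta> power_le_one[of \<delta> 2] by (intro mult_right_mono) auto
      also have "l * \<bar>regular_op (kk u) W u (cl x) - regular_op (kk v) W v (cl x)\<bar> = dist (T u x) (T v x)"
        using l by (simp add: T_apply uv TT_def dist_real_def right_diff_distrib[symmetric] abs_mult)
      finally show ?thesis .
    qed
    then show "dist (T u) (T v) \<le> 3 / 4 * dist u v" by (rule dist_bound)
  qed auto
  then obtain u where u: "u \<in> S" "T u = u" by blast
  show thesis
  proof (rule that[of "apply_bcontfun u" "kk u"])
    show "u x = 1 + l * regular_op (kk u) W u x" if "\<bar>x\<bar> \<le> R" for x
      using T_apply[OF u(1)] u(2) cl_id[OF that] by (simp add: fun_eq_iff TT_def)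
  qed (use meas close[OF u(1)] kk_bounds[OF u(1)] in \<open>auto simp: \<delta>_def kk_def\<close>)
qed

lemma regular_op_measurable:
  assumes "W \<in> borel_measurable borel" "u \<in> borel_measurable borel"
  shows "regular_op k W u \<in> borel_measurable borel"
proof -
  note [measurable] = assms
  have "(\<lambda>x. LINT y|lborel. W y * (regular_part k \<bar>x - y\<bar> * u y)) \<in> borel_measurable borel"
    by (rule lborel.borel_measurable_lebesgue_integral) measurable
  then show ?thesis by (simp add: regular_op_def[abs_def])
qed

section \<open>Expansion of the wave number\<close>

text \<open>
  Inserting the equation for \<open>w\<close> once into \<open>k = - (l / 2) * (LINT x|lborel. W x * w x)\<close> produces the
  integral of \<open>W\<close>, which yields the integrals of \<open>A\<close> and \<open>B\<close>, and \<open>l\<close> times a double integral. In the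
  latter \<open>w\<close> may be replaced by \<open>1\<close>, the kernel by its limit at \<open>k = 0\<close>, and \<open>W\<close> by \<open>A\<close>, each with
  an error of order \<open>l + N\<close>. Here \<open>N\<close> bounds the distance of \<open>W\<close> from \<open>A + l * B\<close> in \<open>L\<^sup>1\<close>.
\<close>

theorem bound_state_expansion:
  assumes R: "0 < R" and W: "potential_on R W" and A: "potential_on R A" and B: "potential_on R B"
    and M: "0 < M" "(LINT x|lborel. \<bar>W x\<bar>) \<le> M" "(LINT x|lborel. \<bar>A x\<bar>) \<le> M" "(LINT x|lborel. \<bar>B x\<bar>) \<le> M"
    and N: "(LINT x|lborel. \<bar>W x - A x - l * B x\<bar>) \<le> N"
    and l: "0 < l" "2 * l * R * M \<le> 1"
    and w: "w \<in> borel_measurable borel" "\<And>x. \<bar>w x - 1\<bar> \<le> 2 * l * R * M"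
    and k: "0 < k" "k \<le> l * M" "k = - (l / 2) * (LINT x|lborel. W x * w x)"
    and eq: "\<And>x. \<bar>x\<bar> \<le> R \<Longrightarrow> w x = 1 + l * regular_op k W w x"
  shows "\<bar>k / l + 1/2 * (LINT x|lborel. A x)
      + l * (1/2 * (LINT x|lborel. A x * regular_op 0 A (\<lambda>_. 1) x) + 1/2 * (LINT x|lborel. B x))\<bar>
    \<le> 2 * N + (2 * R * M\<^sup>2 + 2 * R\<^sup>2 * M ^ 3) * l\<^sup>2"
proof -
  define D where "D x = W x - A x - l * B x" for x
  define P where "P = regular_op k W w"
  define P0 where "P0 = regular_op 0 A (\<lambda>_. 1)"
  have Dpot: "potential_on R D"
    unfolding D_def by (intro potential_on_diff W A B potential_on_scale)
  have Epot: "potential_on R (\<lambda>x. W x - A x)" by (intro potential_on_diff W A)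
  note pot = W A B Dpot Epot
  note int = pot[THEN potential_on_integrable]
  note int_abs = pot[THEN potential_on_abs, THEN potential_on_integrable]
  have N0: "0 \<le> N" by (rule order_trans[OF _ N]) simp
  have w2: "\<bar>w x\<bar> \<le> 2" for x using w(2)[of x] l(2) by linarith
  have E: "(LINT x|lborel. \<bar>W x - A x\<bar>) \<le> N + l * M"
  proof -
    have "(LINT x|lborel. \<bar>W x - A x\<bar>) \<le> (LINT x|lborel. \<bar>D x\<bar> + l * \<bar>B x\<bar>)"
    proof (rule integral_mono)
      show "\<bar>W x - A x\<bar> \<le> \<bar>D x\<bar> + l * \<bar>B x\<bar>" for x
        using abs_triangle_ineq[of "D x" "l * B x"] l by (simp add: D_def abs_mult)
    qed (use int_abs in auto)
    also have "\<dots> = (LINT x|lborel. \<bar>D x\<bar>) + l * (LINT x|lborel. \<bar>B x\<bar>)"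
      using int_abs by simp
    also have "\<dots> \<le> N + l * M"
      using N M(4) l by (intro add_mono mult_left_mono) (auto simp: D_def)
    finally show ?thesis .
  qed
  have measP: "P \<in> borel_measurable borel" "P0 \<in> borel_measurable borel"
    unfolding P_def P0_def using W A w(1)
    by (auto intro!: regular_op_measurable dest: potential_on_measurable)
  have boundP: "\<bar>P x\<bar> \<le> 2 * R * M" if "\<bar>x\<bar> \<le> R" for x
  proof -
    have "\<bar>P x\<bar> \<le> R * 2 * (LINT x|lborel. \<bar>W x\<bar>)"
      unfolding P_def using that R k w2 by (intro regular_op_bound[OF W _ w(1)]) auto
    also have "\<dots> \<le> R * 2 * M" using M R by (intro mult_left_mono) auto
    finally show ?thesis by (simp add: mult_ac)
  qed
  have boundP0: "\<bar>P0 x\<bar> \<le> R * M" if "\<bar>x\<bar> \<le> R" for x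
  proof -
    have "\<bar>P0 x\<bar> \<le> R * 1 * (LINT x|lborel. \<bar>A x\<bar>)"
      unfolding P0_def using that R by (intro regular_op_bound[OF A]) auto
    also have "\<dots> \<le> R * 1 * M" using M R by (intro mult_left_mono) auto
    finally show ?thesis by (simp add: mult_ac)
  qed
  have diffP: "\<bar>P x - P0 x\<bar> \<le> 4 * l * R\<^sup>2 * M\<^sup>2 + R * (N + l * M)" if x: "\<bar>x\<bar> \<le> R" for x
  proof -
    have "\<bar>P x - regular_op 0 W (\<lambda>_. 1) x\<bar>
        \<le> (\<bar>k - 0\<bar> * R\<^sup>2 * 2 + R * (2 * l * R * M)) * (LINT x|lborel. \<bar>W x\<bar>)"
      unfolding P_def using k w w2 R x by (intro regular_op_diff[OF W, where K' = 1]) auto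
    also have "\<dots> \<le> ((l * M) * R\<^sup>2 * 2 + R * (2 * l * R * M)) * M"
      using k l R M by (intro mult_mono add_mono mult_right_mono) auto
    also have "\<dots> = 4 * l * R\<^sup>2 * M\<^sup>2" by (simp add: power2_eq_square)
    finally have 1: "\<bar>P x - regular_op 0 W (\<lambda>_. 1) x\<bar> \<le> 4 * l * R\<^sup>2 * M\<^sup>2" .
    have "regular_op 0 W (\<lambda>_. 1) x - P0 x = regular_op 0 (\<lambda>x. W x - A x) (\<lambda>_. 1) x"
      unfolding P0_def regular_op_def
      by (subst Bochner_Integration.integral_diff[symmetric])
        (use regular_op_integrable[OF W, of 0 "\<lambda>_. 1" 1] regular_op_integrable[OF A, of 0 "\<lambda>_. 1" 1] x R
          in \<open>auto simp: algebra_simps diff_divide_distrib\<close>)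
    moreover have "\<bar>regular_op 0 (\<lambda>x. W x - A x) (\<lambda>_. 1) x\<bar> \<le> R * 1 * (LINT x|lborel. \<bar>W x - A x\<bar>)"
      using R x by (intro regular_op_bound[OF Epot]) auto
    moreover have "\<dots> \<le> R * 1 * (N + l * M)"
      using E R by (intro mult_left_mono) auto
    ultimately show ?thesis using 1 by simp
  qed
  have WP: "integrable lborel (\<lambda>x. W x * P x)" "integrable lborel (\<lambda>x. A x * P x)" "integrable lborel (\<lambda>x. A x * P0 x)"
    using measP boundP boundP0 W A by (blast intro: potential_on_integrable potential_on_mult)+
  have Ww: "(LINT x|lborel. W x * w x) = (LINT x|lborel. W x) + l * (LINT x|lborel. W x * P x)"
  proof -
    have "W x * w x = W x + l * (W x * P x)" for x
      by (cases "\<bar>x\<bar> \<le> R")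
        (use potential_on_outside[OF W, of x] eq[of x] in \<open>auto simp: P_def algebra_simps\<close>)
    then show ?thesis using int WP by simp
  qed
  have split: "(LINT x|lborel. W x * P x) - (LINT x|lborel. A x * P0 x)
    = (LINT x|lborel. (W x - A x) * P x) + (LINT x|lborel. A x * (P x - P0 x))"
  proof -
    have "(LINT x|lborel. (W x - A x) * P x) = (LINT x|lborel. W x * P x) - (LINT x|lborel. A x * P x)"
      using WP by (subst Bochner_Integration.integral_diff[symmetric]) (auto simp: algebra_simps)
    moreover have "(LINT x|lborel. A x * (P x - P0 x)) = (LINT x|lborel. A x * P x) - (LINT x|lborel. A x * P0 x)"
      using WP by (subst Bochner_Integration.integral_diff[symmetric]) (auto simp: algebra_simps)
    ultimately show ?thesis by simp
  qed
  have "\<bar>LINT x|lborel. (W x - A x) * P x\<bar> \<le> (2 * R * M) * (LINT x|lborel. \<bar>W x - A x\<bar>)"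
    using measP boundP by (intro potential_integral_bound[OF Epot]) auto
  also have "\<dots> \<le> (2 * R * M) * (N + l * M)" using E R M by (intro mult_left_mono) auto
  finally have b1: "\<bar>LINT x|lborel. (W x - A x) * P x\<bar> \<le> (2 * R * M) * (N + l * M)" .
  have "\<bar>LINT x|lborel. A x * (P x - P0 x)\<bar>
    \<le> (4 * l * R\<^sup>2 * M\<^sup>2 + R * (N + l * M)) * (LINT x|lborel. \<bar>A x\<bar>)"
    using measP diffP by (intro potential_integral_bound[OF A]) auto
  also have "\<dots> \<le> (4 * l * R\<^sup>2 * M\<^sup>2 + R * (N + l * M)) * M"
    using R M N0 l by (intro mult_left_mono) auto
  finally have b2: "\<bar>LINT x|lborel. A x * (P x - P0 x)\<bar> \<le> (4 * l * R\<^sup>2 * M\<^sup>2 + R * (N + l * M)) * M" .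
  have D: "(LINT x|lborel. D x) = (LINT x|lborel. W x) - (LINT x|lborel. A x) - l * (LINT x|lborel. B x)"
    unfolding D_def using int by simp
  have intD: "\<bar>LINT x|lborel. D x\<bar> \<le> N"
    using order_trans[OF integral_norm_bound[of lborel D]] N[folded D_def] by simp
  have main: "k / l + 1/2 * (LINT x|lborel. A x)
      + l * (1/2 * (LINT x|lborel. A x * P0 x) + 1/2 * (LINT x|lborel. B x))
    = - (1/2) * (LINT x|lborel. D x)
      - l / 2 * ((LINT x|lborel. W x * P x) - (LINT x|lborel. A x * P0 x))"
  proof -
    have kl: "k / l = - (1/2) * ((LINT x|lborel. W x) + l * (LINT x|lborel. W x * P x))"
      unfolding Ww[symmetric] using k(3) l by simp
    show ?thesis unfolding kl D by (simp add: algebra_simps)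
  qed
  have "\<bar>(LINT x|lborel. W x * P x) - (LINT x|lborel. A x * P0 x)\<bar>
    \<le> (2 * R * M) * (N + l * M) + (4 * l * R\<^sup>2 * M\<^sup>2 + R * (N + l * M)) * M"
    unfolding split using b1 b2 by linarith
  then have "l / 2 * \<bar>(LINT x|lborel. W x * P x) - (LINT x|lborel. A x * P0 x)\<bar>
    \<le> l / 2 * ((2 * R * M) * (N + l * M) + (4 * l * R\<^sup>2 * M\<^sup>2 + R * (N + l * M)) * M)"
    using l by (intro mult_left_mono) auto
  also have "\<dots> = 3/4 * (2 * l * R * M) * N + (3/2 * R * M\<^sup>2 + 2 * R\<^sup>2 * M ^ 3) * l\<^sup>2"
    by (simp add: power2_eq_square power3_eq_cube algebra_simps)
  also have "\<dots> \<le> 3/4 * 1 * N + (2 * R * M\<^sup>2 + 2 * R\<^sup>2 * M ^ 3) * l\<^sup>2"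
    using l N0 R by (intro add_mono mult_right_mono mult_left_mono) auto
  finally have "\<bar>l / 2 * ((LINT x|lborel. W x * P x) - (LINT x|lborel. A x * P0 x))\<bar>
    \<le> 3/4 * N + (2 * R * M\<^sup>2 + 2 * R\<^sup>2 * M ^ 3) * l\<^sup>2"
    using l by (simp add: abs_mult)
  then show ?thesis using N0 intD main unfolding P0_def by linarith
qed

section \<open>The Green's function and weak derivatives\<close>

definition green :: "real \<Rightarrow> real \<Rightarrow> real" where
  "green k t = exp (- k * \<bar>t\<bar>) / (2 * k)"

text \<open>
  The derivative of the previous function away from the origin, extended to the origin by its limit
  from the right. It jumps by \<open>-1\<close> there.
\<close>

definition green' :: "real \<Rightarrow> real \<Rightarrow> real" where
  "green' k t = (if t < 0 then exp (k * t) / 2 else - exp (- k * t) / 2)"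

lemma green_measurable [measurable]: "green k \<in> borel_measurable borel" "green' k \<in> borel_measurable borel"
  by (simp_all add: green_def[abs_def] green'_def[abs_def])

lemma green_bounds:
  assumes "0 < k"
  shows "\<bar>green k t\<bar> \<le> 1 / (2 * k)" "\<bar>green' k t\<bar> \<le> 1 / 2"
    "\<bar>green k t\<bar> \<le> exp (- k * \<bar>t\<bar>) / (2 * k)" "\<bar>green' k t\<bar> \<le> exp (- k * \<bar>t\<bar>) / 2"
proof -
  have "exp (- k * \<bar>t\<bar>) \<le> 1" using assms by simp
  then show "\<bar>green k t\<bar> \<le> 1 / (2 * k)" "\<bar>green' k t\<bar> \<le> 1 / 2"
    using assms by (auto simp: green_def green'_def abs_mult divide_right_mono abs_of_neg mult_nonneg_nonpos)
  show "\<bar>green k t\<bar> \<le> exp (- k * \<bar>t\<bar>) / (2 * k)" "\<bar>green' k t\<bar> \<le> exp (- k * \<bar>t\<bar>) / 2"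
    using assms by (auto simp: green_def green'_def abs_mult)
qed

lemma green_eq_regular_part:
  assumes "0 < k"
  shows "green k t = 1 / (2 * k) - regular_part k \<bar>t\<bar>"
  using assms by (simp add: green_def regular_part_def diff_divide_distrib)

lemma continuous_potential_on:
  assumes "continuous_on UNIV f" "\<And>x. R < \<bar>x\<bar> \<Longrightarrow> f x = 0"
  shows "potential_on R f"
proof -
  have "bounded (f ` {-R..R})"
    using assms(1) by (intro compact_imp_bounded compact_continuous_image continuous_on_subset[OF assms(1)]) auto
  then obtain C where C: "\<And>x. x \<in> {-R..R} \<Longrightarrow> \<bar>f x\<bar> \<le> C"
    unfolding bounded_iff by (metis imageI real_norm_def)
  have "\<bar>f x\<bar> \<le> \<bar>C\<bar>" for x
    using C[of x] assms(2)[of x] by (cases "\<bar>x\<bar> \<le> R") (auto simp: abs_le_iff)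
  then show ?thesis
    using assms by (auto simp: potential_on_def intro: borel_measurable_continuous_onI)
qed

lemma test_function_DERIV:
  assumes "test_function \<phi>"
  shows "(\<phi> has_real_derivative deriv \<phi> x) (at x)"
proof -
  have "(deriv ^^ 0) \<phi> field_differentiable at x"
    using assms unfolding test_function_def by blast
  then show ?thesis by (simp add: field_differentiable_derivI)
qed

lemma derivative_zero_outside:
  fixes \<phi> :: "real \<Rightarrow> real"
  assumes "\<And>x. S < \<bar>x\<bar> \<Longrightarrow> \<phi> x = 0" "(\<phi> has_real_derivative D) (at x)" "S < \<bar>x\<bar>"
  shows "D = 0"
proof -
  have "((\<lambda>x. 0) has_real_derivative 0) (at x)" by simp
  then have "(\<phi> has_real_derivative 0) (at x)"
  proof (rule DERIV_cong_ev[THEN iffD1, rotated -1])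
    have "open {x::real. S < \<bar>x\<bar>}" by (intro open_Collect_less continuous_intros)
    then have "\<forall>\<^sub>F z in nhds x. z \<in> {x. S < \<bar>x\<bar>}" using assms(3) by (intro eventually_nhds_in_open) auto
    then show "\<forall>\<^sub>F z in nhds x. 0 = \<phi> z" by eventually_elim (simp add: assms(1))
  qed auto
  then show ?thesis using DERIV_unique assms(2) by blast
qed

lemma test_function_potential_on:
  assumes "test_function \<phi>"
  obtains S where "potential_on S \<phi>" "potential_on S (deriv \<phi>)"
proof -
  note D = test_function_DERIV[OF assms]
  have D1: "deriv \<phi> field_differentiable at x" for x
  proof -
    have "(deriv ^^ 1) \<phi> field_differentiable at x"
      using assms unfolding test_function_def by blast
    then show ?thesis by simp
  qed
  have c: "continuous_on UNIV \<phi>" "continuous_on UNIV (deriv \<phi>)"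
    by (auto intro!: continuous_at_imp_continuous_on DERIV_isCont[OF D]
        field_differentiable_imp_continuous_at[OF D1])
  have "bounded (closure {x. \<phi> x \<noteq> 0})"
    using assms by (auto simp: test_function_def compact_imp_bounded)
  then obtain S where S: "S > 0" "\<And>x. x \<in> closure {x. \<phi> x \<noteq> 0} \<Longrightarrow> norm x \<le> S"
    by (meson bounded_pos)
  have 0: "\<phi> x = 0" if "S < \<bar>x\<bar>" for x
    using S(2)[of x] closure_subset[of "{x. \<phi> x \<noteq> 0}"] that by force
  have "deriv \<phi> x = 0" if "S < \<bar>x\<bar>" for x
    using derivative_zero_outside[OF 0 D that] .
  then have "potential_on S (deriv \<phi>)" by (rule continuous_potential_on[OF c(2)])
  with continuous_potential_on[OF c(1) 0] show thesis by (rule that)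
qed

text \<open>
  The fundamental theorem of calculus on either side of \<open>y\<close>: the boundary terms at infinity vanish with
  \<open>\<phi>\<close>, and those at \<open>y\<close> leave the jump.
\<close>

lemma integration_by_parts_with_jump:
  fixes p q p' q' \<phi> \<phi>' :: "real \<Rightarrow> real"
  assumes p: "\<And>x. (p has_real_derivative p' x) (at x)" and q: "\<And>x. (q has_real_derivative q' x) (at x)"
    and \<phi>: "\<And>x. (\<phi> has_real_derivative \<phi>' x) (at x)" and S: "\<And>x. S < \<bar>x\<bar> \<Longrightarrow> \<phi> x = 0"
  shows "((\<lambda>x. (if x < y then p' x else q' x) * \<phi> x + (if x < y then p x else q x) * \<phi>' x)
      has_integral (p y - q y) * \<phi> y) UNIV"
proof -
  define T where "T = \<bar>S\<bar> + \<bar>y\<bar> + 1"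
  have T: "- T \<le> y" "y \<le> T" "S < \<bar>T\<bar>" "S < \<bar>-T\<bar>" by (auto simp: T_def)
  let ?h = "\<lambda>x. (if x < y then p' x else q' x) * \<phi> x + (if x < y then p x else q x) * \<phi>' x"
  have "((\<lambda>x. p' x * \<phi> x + p x * \<phi>' x) has_integral (p y * \<phi> y - p (-T) * \<phi> (-T))) {-T..y}"
  proof (rule fundamental_theorem_of_calculus[OF T(1)])
    have "((\<lambda>x. p x * \<phi> x) has_real_derivative p' x * \<phi> x + p x * \<phi>' x) (at x within {-T..y})" for x
      by (rule has_field_derivative_at_within[OF DERIV_cong[OF DERIV_mult[OF p \<phi>]]]) simp
    then show "((\<lambda>x. p x * \<phi> x) has_vector_derivative p' x * \<phi> x + p x * \<phi>' x) (at x within {-T..y})" for x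
      by (simp add: has_real_derivative_iff_has_vector_derivative)
  qed
  then have 1: "(?h has_integral p y * \<phi> y) {-T..y}"
    by (rule has_integral_spike_finite[of "{y}", rotated -1, OF has_integral_eq_rhs])
      (use S[OF T(4)] in auto)
  have "((\<lambda>x. q' x * \<phi> x + q x * \<phi>' x) has_integral (q T * \<phi> T - q y * \<phi> y)) {y..T}"
  proof (rule fundamental_theorem_of_calculus[OF T(2)])
    have "((\<lambda>x. q x * \<phi> x) has_real_derivative q' x * \<phi> x + q x * \<phi>' x) (at x within {y..T})" for x
      by (rule has_field_derivative_at_within[OF DERIV_cong[OF DERIV_mult[OF q \<phi>]]]) simp
    then show "((\<lambda>x. q x * \<phi> x) has_vector_derivative q' x * \<phi> x + q x * \<phi>' x) (at x within {y..T})" for x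
      by (simp add: has_real_derivative_iff_has_vector_derivative)
  qed
  then have 2: "(?h has_integral - q y * \<phi> y) {y..T}"
    by (rule has_integral_spike_finite[of "{}", rotated -1, OF has_integral_eq_rhs])
      (use S[OF T(3)] in auto)
  have 3: "(?h has_integral (p y * \<phi> y + - q y * \<phi> y)) {-T..T}"
    by (rule has_integral_combine[OF T(1,2) 1 2])
  have "?h x = 0" if "x \<notin> {-T..T}" for x
  proof -
    have x: "S < \<bar>x\<bar>" using that by (auto simp: T_def)
    show ?thesis using S[OF x] derivative_zero_outside[OF S \<phi> x] by simp
  qed
  then have "(?h has_integral (p y * \<phi> y + - q y * \<phi> y)) UNIV"
    by (intro has_integral_on_superset[OF 3]) auto
  then show ?thesis by (simp add: algebra_simps)
qed

text \<open>
  Two instances of integration by parts: the kernel is continuous at \<open>y\<close>, its derivative jumps by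
  \<open>-1\<close> there, and off \<open>y\<close> the second derivative is \<open>k\<^sup>2\<close> times the kernel.
\<close>

lemma green_parts:
  assumes k: "0 < k" and \<phi>: "test_function \<phi>"
  shows "(LINT x|lborel. green k (x - y) * deriv \<phi> x) = - (LINT x|lborel. green' k (x - y) * \<phi> x)" (is ?A)
    and "(LINT x|lborel. green' k (x - y) * deriv \<phi> x) = \<phi> y - k\<^sup>2 * (LINT x|lborel. green k (x - y) * \<phi> x)" (is ?B)
proof -
  obtain S where S: "potential_on S \<phi>" "potential_on S (deriv \<phi>)"
    using test_function_potential_on[OF \<phi>] .
  note S = S test_function_DERIV[OF \<phi>] potential_on_outside[OF S(1)]
  have int: "integrable lborel (\<lambda>x. green k (x - y) * f x)" "integrable lborel (\<lambda>x. green' k (x - y) * f x)"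
    if "potential_on S f" for f
    using potential_on_mult[OF that, of "\<lambda>x. green k (x - y)", OF _ green_bounds(1)[OF k]]
      potential_on_mult[OF that, of "\<lambda>x. green' k (x - y)", OF _ green_bounds(2)[OF k]]
    by (auto dest!: potential_on_integrable simp: mult.commute)
  have "((\<lambda>x. (if x < y then exp (k * (x - y)) / 2 else - exp (- k * (x - y)) / 2) * \<phi> x
      + (if x < y then exp (k * (x - y)) / (2 * k) else exp (- k * (x - y)) / (2 * k)) * deriv \<phi> x)
      has_integral (exp (k * (y - y)) / (2 * k) - exp (- k * (y - y)) / (2 * k)) * \<phi> y) UNIV"
    using k by (intro integration_by_parts_with_jump[OF _ _ S(3,4)]) (auto intro!: derivative_eq_intros)
  also have "(\<lambda>x. (if x < y then exp (k * (x - y)) / 2 else - exp (- k * (x - y)) / 2) * \<phi> x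
      + (if x < y then exp (k * (x - y)) / (2 * k) else exp (- k * (x - y)) / (2 * k)) * deriv \<phi> x)
    = (\<lambda>x. green' k (x - y) * \<phi> x + green k (x - y) * deriv \<phi> x)"
    by (auto simp: green_def green'_def fun_eq_iff algebra_simps)
  finally have 1: "((\<lambda>x. green' k (x - y) * \<phi> x + green k (x - y) * deriv \<phi> x) has_integral 0) UNIV" by simp
  have "(LINT x|lborel. green' k (x - y) * \<phi> x + green k (x - y) * deriv \<phi> x) = 0"
    by (rule has_integral_unique[OF has_integral_integral_lborel 1])
      (intro Bochner_Integration.integrable_add int S(1,2))
  then show ?A using int S(1,2) by simp
  have "((\<lambda>x. (if x < y then k * exp (k * (x - y)) / 2 else k * exp (- k * (x - y)) / 2) * \<phi> x
      + (if x < y then exp (k * (x - y)) / 2 else - exp (- k * (x - y)) / 2) * deriv \<phi> x)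
      has_integral (exp (k * (y - y)) / 2 - - exp (- k * (y - y)) / 2) * \<phi> y) UNIV"
    using k by (intro integration_by_parts_with_jump[OF _ _ S(3,4)]) (auto intro!: derivative_eq_intros)
  also have "(\<lambda>x. (if x < y then k * exp (k * (x - y)) / 2 else k * exp (- k * (x - y)) / 2) * \<phi> x
      + (if x < y then exp (k * (x - y)) / 2 else - exp (- k * (x - y)) / 2) * deriv \<phi> x)
    = (\<lambda>x. k\<^sup>2 * (green k (x - y) * \<phi> x) + green' k (x - y) * deriv \<phi> x)"
    using k by (auto simp: green_def green'_def fun_eq_iff power2_eq_square algebra_simps)
  finally have 2: "((\<lambda>x. k\<^sup>2 * (green k (x - y) * \<phi> x) + green' k (x - y) * deriv \<phi> x) has_integral \<phi> y) UNIV" by simp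
  have "(LINT x|lborel. k\<^sup>2 * (green k (x - y) * \<phi> x) + green' k (x - y) * deriv \<phi> x) = \<phi> y"
    by (rule has_integral_unique[OF has_integral_integral_lborel 2])
      (intro Bochner_Integration.integrable_add integrable_mult_right int S(1,2))
  then show ?B using int S(1,2) by simp
qed

lemma potential_product_integrable:
  fixes K :: "real \<Rightarrow> real \<Rightarrow> real"
  assumes f: "potential_on R f" and g: "potential_on S g"
    and K: "case_prod K \<in> borel_measurable (borel \<Otimes>\<^sub>M borel)" "\<And>x y. \<bar>x\<bar> \<le> R \<Longrightarrow> \<bar>y\<bar> \<le> S \<Longrightarrow> \<bar>K x y\<bar> \<le> C"
  shows "integrable (lborel \<Otimes>\<^sub>M lborel) (\<lambda>(x, y). f x * K x y * g y)"
proof -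
  obtain Cf where Cf: "Cf > 0" "\<And>x. \<bar>f x\<bar> \<le> Cf"
    using potential_on_bounded[OF f] by blast
  obtain Cg where Cg: "Cg > 0" "\<And>x. \<bar>g x\<bar> \<le> Cg"
    using potential_on_bounded[OF g] by blast
  note [measurable] = potential_on_measurable[OF f] potential_on_measurable[OF g] K(1)
  have "integrable (lborel :: (real \<times> real) measure) (\<lambda>p. indicator (cbox (-R, -S) (R, S)) p * (Cf * \<bar>C\<bar> * Cg))"
    by (intro integrable_mult_left integrable_real_indicator) (auto simp: emeasure_lborel_cbox_eq)
  then have "integrable (lborel \<Otimes>\<^sub>M lborel) (\<lambda>p. indicator (cbox (-R, -S) (R, S)) p * (Cf * \<bar>C\<bar> * Cg))"
    by (simp add: lborel_prod)
  then show ?thesis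
  proof (rule Bochner_Integration.integrable_bound)
    show "(\<lambda>(x, y). f x * K x y * g y) \<in> borel_measurable (lborel \<Otimes>\<^sub>M lborel)"
      by measurable
    have "\<bar>f x * K x y * g y\<bar> \<le> \<bar>indicator (cbox (-R, -S) (R, S)) (x, y) * (Cf * \<bar>C\<bar> * Cg)\<bar>" for x y
    proof (cases "\<bar>x\<bar> \<le> R \<and> \<bar>y\<bar> \<le> S")
      case True
      then have "(x, y) \<in> cbox (-R, -S) (R, S)" by (auto simp: cbox_Pair_eq)
      moreover have "\<bar>f x\<bar> * \<bar>K x y\<bar> * \<bar>g y\<bar> \<le> Cf * \<bar>C\<bar> * Cg"
        using True K(2)[of x y] Cf Cg by (intro mult_mono) auto
      ultimately show ?thesis using Cf Cg by (simp add: abs_mult)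
    next
      case False
      then show ?thesis using potential_on_outside[OF f, of x] potential_on_outside[OF g, of y] by auto
    qed
    then show "AE p in lborel \<Otimes>\<^sub>M lborel. norm ((\<lambda>(x, y). f x * K x y * g y) p)
        \<le> norm (indicator (cbox (-R, -S) (R, S)) p * (Cf * \<bar>C\<bar> * Cg))"
      by (intro AE_I2) (auto split: prod.split)
  qed
qed

definition convolution :: "(real \<Rightarrow> real) \<Rightarrow> (real \<Rightarrow> real) \<Rightarrow> real \<Rightarrow> real" where
  "convolution K g x = (LINT y|lborel. K (x - y) * g y)"

lemma convolution_measurable:
  assumes "K \<in> borel_measurable borel" "g \<in> borel_measurable borel"
  shows "convolution K g \<in> borel_measurable borel"
proof -
  note [measurable] = assms
  have "(\<lambda>x. LINT y|lborel. K (x - y) * g y) \<in> borel_measurable borel"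
    by (rule lborel.borel_measurable_lebesgue_integral) measurable
  then show ?thesis by (simp add: convolution_def[abs_def])
qed

lemma integral_convolution_mult:
  assumes g: "potential_on R g" and f: "potential_on S f"
    and K: "K \<in> borel_measurable borel" "\<And>t. \<bar>K t\<bar> \<le> C"
  shows "(LINT x|lborel. convolution K g x * f x) = (LINT y|lborel. g y * (LINT x|lborel. K (x - y) * f x))"
proof -
  note [measurable] = K(1)
  have "(LINT x|lborel. convolution K g x * f x) = (LINT x|lborel. LINT y|lborel. f x * K (x - y) * g y)"
  proof (rule Bochner_Integration.integral_cong[OF refl])
    fix x
    have "convolution K g x * f x = f x * (LINT y|lborel. K (x - y) * g y)" by (simp add: convolution_def)
    also have "\<dots> = (LINT y|lborel. f x * (K (x - y) * g y))" by simp
    finally show "convolution K g x * f x = (LINT y|lborel. f x * K (x - y) * g y)" by (simp add: mult.assoc)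
  qed
  also have "\<dots> = (LINT y|lborel. LINT x|lborel. f x * K (x - y) * g y)"
    by (rule lborel_pair.Fubini_integral[symmetric])
      (rule potential_product_integrable[OF f g], auto intro: K(2))
  also have "\<dots> = (LINT y|lborel. g y * (LINT x|lborel. K (x - y) * f x))"
  proof (rule Bochner_Integration.integral_cong[OF refl])
    fix y
    have "(LINT x|lborel. g y * (K (x - y) * f x)) = g y * (LINT x|lborel. K (x - y) * f x)" by simp
    then show "(LINT x|lborel. f x * K (x - y) * g y) = g y * (LINT x|lborel. K (x - y) * f x)"
      by (simp add: mult_ac)
  qed
  finally show ?thesis .
qed

lemma LINT_lebesgue_of_real:
  assumes "f \<in> borel_measurable borel" "g \<in> borel_measurable borel"
  shows "(LINT x|lebesgue. complex_of_real (f x) * complex_of_real (g x)) = complex_of_real (LINT x|lborel. f x * g x)"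
proof -
  note [measurable] = assms
  have "(LINT x|lebesgue. complex_of_real (f x) * complex_of_real (g x)) = (LINT x|lborel. complex_of_real (f x * g x))"
    by (subst integral_completion) auto
  also have "\<dots> = complex_of_real (LINT x|lborel. f x * g x)"
    by (rule integral_complex_of_real)
  finally show ?thesis .
qed

lemma has_weak_deriv_of_real:
  assumes "f \<in> borel_measurable borel" "g \<in> borel_measurable borel"
    and "\<And>\<phi>. test_function \<phi> \<Longrightarrow> (LINT x|lborel. f x * deriv \<phi> x) = - (LINT x|lborel. g x * \<phi> x)"
  shows "has_weak_deriv (\<lambda>x. complex_of_real (f x)) (\<lambda>x. complex_of_real (g x))"
  unfolding has_weak_deriv_def
proof (intro allI impI)
  fix \<phi> assume \<phi>: "test_function \<phi>"
  then obtain S where "potential_on S \<phi>" "potential_on S (deriv \<phi>)"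
    using test_function_potential_on[OF \<phi>] by blast
  then show "(LINT x|lebesgue. complex_of_real (f x) * complex_of_real (deriv \<phi> x)) =
      - (LINT x|lebesgue. complex_of_real (g x) * complex_of_real (\<phi> x))"
    using assms \<phi> by (simp add: LINT_lebesgue_of_real potential_on_measurable)
qed

text \<open>
  By Fubini the derivative falls on the kernel alone. The jump of \<^const>\<open>green'\<close> reproduces \<open>g\<close>,
  so that the convolution \<open>u\<close> solves \<open>- u'' + k\<^sup>2 * u = g\<close> weakly.
\<close>

lemma green_convolution_weak_deriv:
  assumes k: "0 < k" and g: "potential_on R g"
  shows "has_weak_deriv (\<lambda>x. complex_of_real (convolution (green k) g x)) (\<lambda>x. complex_of_real (convolution (green' k) g x))"
    and "has_weak_deriv (\<lambda>x. complex_of_real (convolution (green' k) g x))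
      (\<lambda>x. complex_of_real (k\<^sup>2 * convolution (green k) g x - g x))"
proof -
  note meas [measurable] = potential_on_measurable[OF g] convolution_measurable[OF green_measurable(1) potential_on_measurable[OF g]]
    convolution_measurable[OF green_measurable(2) potential_on_measurable[OF g]]
  note fub = integral_convolution_mult[OF g _ green_measurable(1) green_bounds(1)[OF k]]
    integral_convolution_mult[OF g _ green_measurable(2) green_bounds(2)[OF k]]
  show "has_weak_deriv (\<lambda>x. complex_of_real (convolution (green k) g x)) (\<lambda>x. complex_of_real (convolution (green' k) g x))"
  proof (rule has_weak_deriv_of_real)
    fix \<phi> assume \<phi>: "test_function \<phi>"
    then obtain S where S: "potential_on S \<phi>" "potential_on S (deriv \<phi>)"
      using test_function_potential_on[OF \<phi>] by blast
    show "(LINT x|lborel. convolution (green k) g x * deriv \<phi> x) = - (LINT x|lborel. convolution (green' k) g x * \<phi> x)"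
      by (simp add: fub(1)[OF S(2)] fub(2)[OF S(1)] green_parts(1)[OF k \<phi>])
  qed measurable
  show "has_weak_deriv (\<lambda>x. complex_of_real (convolution (green' k) g x))
      (\<lambda>x. complex_of_real (k\<^sup>2 * convolution (green k) g x - g x))"
  proof (rule has_weak_deriv_of_real)
    fix \<phi> assume \<phi>: "test_function \<phi>"
    then obtain S where S: "potential_on S \<phi>" "potential_on S (deriv \<phi>)"
      using test_function_potential_on[OF \<phi>] by blast
    have bnd: "\<bar>convolution (green k) g x\<bar> \<le> 1 / (2 * k) * (LINT y|lborel. \<bar>g y\<bar>)" for x
      using potential_integral_bound[OF g, of "\<lambda>y. green k (x - y)" "1 / (2 * k)"] green_bounds(1)[OF k]
      by (simp add: convolution_def mult.commute)
    have i1: "integrable lborel (\<lambda>x. convolution (green k) g x * \<phi> x)"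
      using potential_on_integrable[OF potential_on_mult[OF S(1) meas(2) bnd]] by (simp add: mult.commute)
    obtain C where C: "\<And>x. \<bar>\<phi> x\<bar> \<le> C" using potential_on_bounded[OF S(1)] by blast
    have i2: "integrable lborel (\<lambda>x. g x * \<phi> x)"
      using potential_on_integrable[OF potential_on_mult[OF g potential_on_measurable[OF S(1)] C]] .
    have i3: "integrable lborel (\<lambda>y. g y * (LINT x|lborel. green k (x - y) * \<phi> x))"
    proof (rule potential_on_integrable[OF potential_on_mult[OF g]])
      note [measurable] = potential_on_measurable[OF S(1)]
      show "(\<lambda>y. LINT x|lborel. green k (x - y) * \<phi> x) \<in> borel_measurable borel"
        by (rule lborel.borel_measurable_lebesgue_integral) measurable
      show "\<bar>LINT x|lborel. green k (x - y) * \<phi> x\<bar> \<le> 1 / (2 * k) * (LINT y|lborel. \<bar>\<phi> y\<bar>)" for y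
        using potential_integral_bound[OF S(1), of "\<lambda>x. green k (x - y)" "1 / (2 * k)"] green_bounds(1)[OF k]
        by (simp add: mult.commute)
    qed
    have "(LINT x|lborel. convolution (green' k) g x * deriv \<phi> x)
      = (LINT y|lborel. g y * \<phi> y - k\<^sup>2 * (g y * (LINT x|lborel. green k (x - y) * \<phi> x)))"
      unfolding fub(2)[OF S(2)] green_parts(2)[OF k \<phi>] by (simp add: algebra_simps)
    also have "\<dots> = (LINT y|lborel. g y * \<phi> y) - k\<^sup>2 * (LINT x|lborel. convolution (green k) g x * \<phi> x)"
      using i2 i3 by (simp add: fub(1)[OF S(1)])
    also have "\<dots> = - (LINT x|lborel. (k\<^sup>2 * convolution (green k) g x - g x) * \<phi> x)"
      using i1 i2 by (simp add: left_diff_distrib mult.assoc)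
    finally show "(LINT x|lborel. convolution (green' k) g x * deriv \<phi> x)
      = - (LINT x|lborel. (k\<^sup>2 * convolution (green k) g x - g x) * \<phi> x)" .
  qed measurable
qed

section \<open>The eigenfunction\<close>

lemma integrable_exp_abs:
  assumes "0 < (a::real)"
  shows "integrable lborel (\<lambda>x. exp (- a * \<bar>x\<bar>))"
proof -
  have "set_integrable lebesgue {0..} (\<lambda>x. exp (- a * x))"
    using assms by (intro nonnegative_absolutely_integrable_1 integrable_on_exp_minus_to_infinity) auto
  then have "integrable lebesgue (\<lambda>x. indicator {0..} x * exp (- a * x))"
    by (simp add: set_integrable_def)
  then have 1: "integrable lborel (\<lambda>x. indicator {0..} x * exp (- a * x))"
    by (subst (asm) integrable_completion) auto
  then have 2: "integrable lborel (\<lambda>x. indicator {0..} (- x) * exp (- a * (- x)))"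
    using lborel_integrable_real_affine[OF 1, of "-1" 0] by simp
  from Bochner_Integration.integrable_add[OF 1 2] show ?thesis
    by (rule Bochner_Integration.integrable_bound) (auto simp: indicator_def abs_if)
qed

lemma L2_of_exp_decay:
  assumes k: "0 < k" and f: "f \<in> borel_measurable borel" and C: "\<And>x. \<bar>f x\<bar> \<le> C * exp (- k * \<bar>x\<bar>)"
  shows "(\<lambda>x. complex_of_real (f x)) \<in> L2"
proof -
  note [measurable] = f
  have "integrable lborel (\<lambda>x. C\<^sup>2 * exp (- (2 * k) * \<bar>x\<bar>))"
    using integrable_exp_abs[of "2 * k"] k by simp
  then have "integrable lborel (\<lambda>x. (f x)\<^sup>2)"
  proof (rule Bochner_Integration.integrable_bound)
    have "(f x)\<^sup>2 \<le> C\<^sup>2 * exp (- (2 * k) * \<bar>x\<bar>)" for x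
    proof -
      have "\<bar>f x\<bar>\<^sup>2 \<le> (C * exp (- k * \<bar>x\<bar>))\<^sup>2" using C[of x] by (intro power_mono) auto
      also have "\<dots> = C\<^sup>2 * exp (- (2 * k) * \<bar>x\<bar>)"
        by (simp add: power_mult_distrib exp_double[symmetric] mult_ac)
      finally show ?thesis by simp
    qed
    then show "AE x in lborel. norm ((f x)\<^sup>2) \<le> norm (C\<^sup>2 * exp (- (2 * k) * \<bar>x\<bar>))" by simp
  qed measurable
  then have "integrable lebesgue (\<lambda>x. (f x)\<^sup>2)" by (simp add: integrable_completion)
  moreover have "(\<lambda>x. complex_of_real (f x)) \<in> borel_measurable lebesgue"
    by (intro measurable_completion) measurable
  ultimately show ?thesis by (simp add: L2_def)
qed

text \<open>
  Shifting the kernel by at most \<open>R\<close> costs a factor \<open>exp (k * R)\<close>.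
\<close>

lemma convolution_exp_decay:
  assumes k: "0 < k" and g: "potential_on R g" and K: "K \<in> borel_measurable borel" "\<And>t. \<bar>K t\<bar> \<le> C * exp (- k * \<bar>t\<bar>)"
  shows "\<bar>convolution K g x\<bar> \<le> (C * exp (k * R) * (LINT y|lborel. \<bar>g y\<bar>)) * exp (- k * \<bar>x\<bar>)"
proof -
  have C: "0 \<le> C" using K(2)[of 0] by simp
  note [measurable] = K(1)
  have "\<bar>LINT y|lborel. g y * K (x - y)\<bar> \<le> (C * exp (k * R) * exp (- k * \<bar>x\<bar>)) * (LINT y|lborel. \<bar>g y\<bar>)"
  proof (rule potential_integral_bound[OF g])
    fix y assume y: "\<bar>y\<bar> \<le> R"
    have "- k * \<bar>x - y\<bar> \<le> k * R + - k * \<bar>x\<bar>"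
    proof -
      have "\<bar>x\<bar> - R \<le> \<bar>x - y\<bar>" using y by linarith
      then have "k * (\<bar>x\<bar> - R) \<le> k * \<bar>x - y\<bar>" using k by (intro mult_left_mono) auto
      then show ?thesis by (simp add: algebra_simps)
    qed
    then have "exp (- k * \<bar>x - y\<bar>) \<le> exp (k * R) * exp (- k * \<bar>x\<bar>)"
      unfolding exp_add[symmetric] by simp
    then have "C * exp (- k * \<bar>x - y\<bar>) \<le> C * (exp (k * R) * exp (- k * \<bar>x\<bar>))"
      using C by (intro mult_left_mono) auto
    then show "\<bar>K (x - y)\<bar> \<le> C * exp (k * R) * exp (- k * \<bar>x\<bar>)"
      using K(2)[of "x - y"] by (simp add: mult.assoc)
  qed measurable
  then show ?thesis by (simp add: convolution_def mult_ac)
qed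

text \<open>
  The eigenfunction is the convolution \<open>u\<close> of \<^const>\<open>green\<close> with \<open>- l * W * w\<close>. The relation between
  \<open>k\<close> and \<open>w\<close> says that the constant part \<open>1 / (2 * k)\<close> of the kernel contributes exactly \<open>1\<close>, so the
  equation for \<open>w\<close> gives \<open>u = w\<close> on the interval that carries \<open>W\<close>. Therefore \<open>- l * W * w\<close> equals
  \<open>- l * W * u\<close> everywhere, and \<open>u\<close> solves the eigenvalue equation; it is positive on the interval
  since \<open>w\<close> stays close to \<open>1\<close>.
\<close>

theorem bound_state_eigenvalue:
  assumes R: "0 < R" and W: "potential_on R W" and k: "0 < k" and l: "l \<noteq> 0"
    and w: "w \<in> borel_measurable borel" "\<And>x. \<bar>w x - 1\<bar> \<le> d" and d: "d < 1"
    and keq: "k = - (l / 2) * (LINT x|lborel. W x * w x)"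
    and eq: "\<And>x. \<bar>x\<bar> \<le> R \<Longrightarrow> w x = 1 + l * regular_op k W w x"
    and q: "AE x in lebesgue. q x = W x"
  shows "eigenvalue (schroedinger (\<lambda>x. l * q x)) (complex_of_real (- k\<^sup>2))"
proof -
  define g where "g x = - l * (W x * w x)" for x
  have wb: "\<bar>w x\<bar> \<le> d + 1" for x using w(2)[of x] by linarith
  have Ww: "potential_on R (\<lambda>x. W x * w x)"
    by (rule potential_on_mult[OF W w(1) wb])
  have g: "potential_on R g"
    unfolding g_def by (rule potential_on_scale[OF Ww])
  define u where "u = convolution (green k) g"
  define v where "v = convolution (green' k) g"
  note gm [measurable] = potential_on_measurable[OF g]
  have meas [measurable]: "u \<in> borel_measurable borel" "v \<in> borel_measurable borel"
    unfolding u_def v_def by (auto intro!: convolution_measurable gm)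
  have uw: "u x = w x" if x: "\<bar>x\<bar> \<le> R" for x
  proof -
    have int: "integrable lborel (\<lambda>y. W y * w y)" "integrable lborel (\<lambda>y. W y * (regular_part k \<bar>x - y\<bar> * w y))"
      using potential_on_integrable[OF Ww] regular_op_integrable[OF W _ w(1) wb x] k R by auto
    have "u x = (LINT y|lborel. (- l / (2 * k)) * (W y * w y) + l * (W y * (regular_part k \<bar>x - y\<bar> * w y)))"
      unfolding u_def convolution_def g_def green_eq_regular_part[OF k]
      by (rule Bochner_Integration.integral_cong) (auto simp: algebra_simps)
    also have "\<dots> = (- l / (2 * k)) * (LINT y|lborel. W y * w y) + l * regular_op k W w x"
      using int by (simp add: regular_op_def)
    also have "(- l / (2 * k)) * (LINT y|lborel. W y * w y) = 1"
    proof -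
      have "(LINT y|lborel. W y * w y) = - 2 * k / l" using keq l by (simp add: field_simps)
      then show ?thesis using k l by simp
    qed
    finally show ?thesis using eq[OF x] by simp
  qed
  have decay: "\<bar>u x\<bar> \<le> (1 / (2 * k) * exp (k * R) * (LINT y|lborel. \<bar>g y\<bar>)) * exp (- k * \<bar>x\<bar>)"
    "\<bar>v x\<bar> \<le> (1 / 2 * exp (k * R) * (LINT y|lborel. \<bar>g y\<bar>)) * exp (- k * \<bar>x\<bar>)" for x
    unfolding u_def v_def using green_bounds(3,4)[OF k]
    by (intro convolution_exp_decay[OF k g]; simp)+
  have uL: "(\<lambda>x. complex_of_real (u x)) \<in> L2" and vL: "(\<lambda>x. complex_of_real (v x)) \<in> L2"
    by (rule L2_of_exp_decay[OF k _ decay(1)] L2_of_exp_decay[OF k _ decay(2)]; simp)+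
  obtain G where G: "0 < G" "\<And>x. \<bar>g x\<bar> \<le> G" using potential_on_bounded[OF g] by blast
  have gdecay: "\<bar>g x\<bar> \<le> G * exp (k * R) * exp (- k * \<bar>x\<bar>)" for x
  proof (cases "\<bar>x\<bar> \<le> R")
    case True
    then have "k * \<bar>x\<bar> \<le> k * R" using k by (intro mult_left_mono) auto
    then have "1 \<le> exp (k * R) * exp (- k * \<bar>x\<bar>)" unfolding exp_add[symmetric] by simp
    then have "G * 1 \<le> G * (exp (k * R) * exp (- k * \<bar>x\<bar>))" using G by (intro mult_left_mono) auto
    then show ?thesis using G(2)[of x] by (simp add: mult.assoc)
  next
    case False
    then show ?thesis using potential_on_outside[OF g, of x] G by simp
  qed
  obtain Cu where Cu: "\<And>x. \<bar>u x\<bar> \<le> Cu * exp (- k * \<bar>x\<bar>)" using decay(1) by blast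
  have "\<bar>k\<^sup>2 * u x - g x\<bar> \<le> (k\<^sup>2 * Cu + G * exp (k * R)) * exp (- k * \<bar>x\<bar>)" for x
  proof -
    have "\<bar>k\<^sup>2 * u x - g x\<bar> \<le> k\<^sup>2 * \<bar>u x\<bar> + \<bar>g x\<bar>"
      using abs_triangle_ineq4[of "k\<^sup>2 * u x" "g x"] by (simp add: abs_mult)
    also have "\<dots> \<le> k\<^sup>2 * (Cu * exp (- k * \<bar>x\<bar>)) + G * exp (k * R) * exp (- k * \<bar>x\<bar>)"
      using Cu gdecay by (intro add_mono mult_left_mono) auto
    finally show ?thesis by (simp add: algebra_simps)
  qed
  then have wL: "(\<lambda>x. complex_of_real (k\<^sup>2 * u x - g x)) \<in> L2"
    by (intro L2_of_exp_decay[OF k]) measurable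
  have "\<bar>- k\<^sup>2 * u x\<bar> \<le> (k\<^sup>2 * Cu) * exp (- k * \<bar>x\<bar>)" for x
    using mult_left_mono[OF Cu[of x], of "k\<^sup>2"] by (simp add: abs_mult mult.assoc)
  then have fL: "(\<lambda>x. complex_of_real (- k\<^sup>2 * u x)) \<in> L2"
    by (intro L2_of_exp_decay[OF k]) measurable
  note wd = green_convolution_weak_deriv[OF k g, folded u_def v_def]
  have ae: "AE x in lebesgue. complex_of_real (- k\<^sup>2 * u x)
      = - complex_of_real (k\<^sup>2 * u x - g x) + complex_of_real (l * q x) * complex_of_real (u x)"
    using q
  proof eventually_elim
    case (elim x)
    have "g x = - l * (W x * u x)"
      using uw[of x] potential_on_outside[OF W, of x] by (cases "\<bar>x\<bar> \<le> R") (auto simp: g_def)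
    then have "- k\<^sup>2 * u x = - (k\<^sup>2 * u x - g x) + (l * q x) * u x"
      using elim by simp
    then show ?case by (metis of_real_add of_real_minus of_real_mult)
  qed
  have "((\<lambda>x. complex_of_real (u x)), (\<lambda>x. complex_of_real (- k\<^sup>2 * u x))) \<in> schroedinger (\<lambda>x. l * q x)"
    unfolding schroedinger_def sobolev22_def using uL vL wL fL wd ae by blast
  moreover have "\<not> (AE x in lebesgue. complex_of_real (u x) = 0)"
  proof
    assume "AE x in lebesgue. complex_of_real (u x) = 0"
    moreover have "u x \<noteq> 0" if "x \<in> {-R..R}" for x
      using uw[of x] w(2)[of x] d that by (auto simp: abs_le_iff)
    ultimately have "AE x in lebesgue. x \<notin> {-R..R}" by (auto elim!: eventually_mono)
    then have "AE x in lborel. x \<notin> {-R..R}" by (simp add: AE_completion_iff)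
    then have "emeasure lborel {-R..R} = 0" by (subst (asm) AE_iff_measurable[of "{-R..R}"]) auto
    then show False using R by simp
  qed
  ultimately show ?thesis
    unfolding eigenvalue_def by (auto intro!: bexI[rotated])
qed

section \<open>Borel representatives of Lebesgue potentials\<close>

text \<open>
  The union that defines the complement of the support is uncountable; by the Lindeloef property a
  countable subfamily has the same union.
\<close>

lemma AE_zero_outside_ess_support: "AE x in lebesgue. x \<notin> ess_support f \<longrightarrow> f x = 0"
proof -
  define F where "F = {U. open U \<and> (AE x in lebesgue. x \<in> U \<longrightarrow> f x = 0)}"
  obtain F' where F': "F' \<subseteq> F" "countable F'" "\<Union>F' = \<Union>F"
    using Lindelof[of F] by (auto simp: F_def)
  have "AE x in lebesgue. \<forall>U\<in>F'. x \<in> U \<longrightarrow> f x = 0"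
    using F' by (subst AE_ball_countable) (auto simp: F_def)
  then show ?thesis
    by (rule eventually_mono) (use F'(3) in \<open>auto simp: ess_support_def F_def[symmetric]\<close>)
qed

lemma ess_support_representative:
  assumes f: "f \<in> Linf" and supp: "ess_support f \<subseteq> {-R..R}"
  obtains g where "potential_on R g" "AE x in lebesgue. f x = g x"
proof -
  obtain C where C: "AE x in lebesgue. \<bar>f x\<bar> \<le> C" and meas: "f \<in> borel_measurable lebesgue"
    using f by (auto simp: Linf_def)
  obtain h where h [measurable]: "h \<in> borel_measurable lborel" and fh: "AE x in lborel. f x = h x"
    using completion_ex_borel_measurable_real[OF meas] by blast
  define g where "g x = indicator {-R..R} x * max (- \<bar>C\<bar>) (min \<bar>C\<bar> (h x))" for x
  have "g \<in> borel_measurable borel" using h unfolding g_def by measurable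
  moreover have "\<bar>g x\<bar> \<le> \<bar>C\<bar>" for x by (auto simp: g_def indicator_def)
  moreover have "g x = 0" if "R < \<bar>x\<bar>" for x using that by (auto simp: g_def indicator_def)
  ultimately have "potential_on R g" unfolding potential_on_def by blast
  moreover have "AE x in lebesgue. f x = g x"
    using AE_zero_outside_ess_support[of f] C AE_completion[OF fh]
  proof eventually_elim
    case (elim x)
    show ?case
    proof (cases "x \<in> {-R..R}")
      case True
      then show ?thesis using elim by (auto simp: g_def)
    next
      case False
      then have "f x = 0" using elim(1) supp by auto
      then show ?thesis using False by (simp add: g_def)
    qed
  qed
  ultimately show thesis by (rule that)
qed

lemma integral_lebesgue_representative:
  fixes f g :: "'a :: euclidean_space \<Rightarrow> real"
  assumes g: "g \<in> borel_measurable borel" and ae: "AE x in lebesgue. f x = g x"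
  shows "(LINT x|lebesgue. f x) = (LINT x|lborel. g x)"
proof -
  have gm: "g \<in> borel_measurable lebesgue" using g by (intro measurable_completion) simp
  have "AE x in lebesgue. g x = f x" using ae by (rule eventually_mono) simp
  then have fm: "f \<in> borel_measurable lebesgue"
    by (intro borel_measurable_AE[OF gm])
  have "(LINT x|lebesgue. f x) = (LINT x|lebesgue. g x)"
    by (rule integral_cong_AE[OF fm gm ae])
  then show ?thesis using g by (simp add: integral_completion)
qed

text \<open>
  A Lebesgue null set is first enlarged to a Borel null set, so that the product measure of Borel sets
  applies; Lebesgue measure on the plane is not the product of Lebesgue measures but its completion.
\<close>

lemma AE_lebesgue_pair:
  assumes "AE x in (lebesgue :: real measure). P x"
  shows "AE p in (lebesgue :: (real \<times> real) measure). P (fst p) \<and> P (snd p)"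
proof -
  have "AE x in (lborel :: real measure). P x" using assms by (simp add: AE_completion_iff)
  then obtain N where N: "{x \<in> space lborel. \<not> P x} \<subseteq> N" "N \<in> null_sets (lborel :: real measure)"
    unfolding eventually_ae_filter by blast
  have N' [measurable]: "N \<in> sets borel" using N(2) by auto
  have ae: "AE x in lborel. x \<notin> N" by (rule AE_not_in[OF N(2)])
  have "AE p in lborel \<Otimes>\<^sub>M lborel. fst p \<notin> N \<and> snd p \<notin> N"
  proof (rule lborel_pair.AE_pair_measure)
    show "{x \<in> space (lborel \<Otimes>\<^sub>M lborel). fst x \<notin> N \<and> snd x \<notin> N} \<in> sets (lborel \<Otimes>\<^sub>M lborel)"
      by measurable
    show "AE x in lborel. AE y in lborel. fst (x, y) \<notin> N \<and> snd (x, y) \<notin> N"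
      using ae by eventually_elim (use ae in simp)
  qed
  then have "AE p in (lborel :: (real \<times> real) measure). P (fst p) \<and> P (snd p)"
    unfolding lborel_prod by (rule eventually_mono) (use N(1) in auto)
  then show ?thesis by (rule AE_completion)
qed

text \<open>
  The factor \<open>2\<close> compensates for the kernel \<open>\<bar>x - y\<bar> / 2\<close>, the limit at wave number \<open>0\<close>.
\<close>

lemma double_int_representative:
  assumes A: "potential_on R A" and ae: "AE x in lebesgue. V x = A x"
  shows "double_int V = 2 * (LINT x|lborel. A x * regular_op 0 A (\<lambda>_. 1) x)"
proof -
  note [measurable] = potential_on_measurable[OF A]
  have int: "integrable (lborel \<Otimes>\<^sub>M lborel) (\<lambda>(x, y). A x * \<bar>x - y\<bar> * A y)"
    by (rule potential_product_integrable[OF A A, where C = "2 * R"]) auto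
  have "double_int V = (LINT p|lborel. (\<lambda>(x, y). A x * \<bar>x - y\<bar> * A y) p)"
    unfolding double_int_def
  proof (rule integral_lebesgue_representative)
    have "(\<lambda>(x, y). A x * \<bar>x - y\<bar> * A y) \<in> borel_measurable (borel \<Otimes>\<^sub>M borel)" by measurable
    then show "(\<lambda>(x, y). A x * \<bar>x - y\<bar> * A y) \<in> borel_measurable borel" by (simp add: borel_prod)
    show "AE p in lebesgue. (\<lambda>(x, y). V x * \<bar>x - y\<bar> * V y) p = (\<lambda>(x, y). A x * \<bar>x - y\<bar> * A y) p"
      using AE_lebesgue_pair[OF ae] by eventually_elim auto
  qed
  also have "\<dots> = (LINT p|(lborel \<Otimes>\<^sub>M lborel). (\<lambda>(x, y). A x * \<bar>x - y\<bar> * A y) p)"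
    by (simp only: lborel_prod)
  also have "\<dots> = (LINT x|lborel. LINT y|lborel. A x * \<bar>x - y\<bar> * A y)"
    using lborel_pair.integral_fst[OF int] by simp
  also have "\<dots> = (LINT x|lborel. 2 * (A x * regular_op 0 A (\<lambda>_. 1) x))"
  proof (rule Bochner_Integration.integral_cong[OF refl])
    fix x
    have "(LINT y|lborel. (2 * A x) * (A y * (regular_part 0 \<bar>x - y\<bar> * 1))) = (2 * A x) * regular_op 0 A (\<lambda>_. 1) x"
      unfolding regular_op_def by (rule integral_mult_right_zero)
    then show "(LINT y|lborel. A x * \<bar>x - y\<bar> * A y) = 2 * (A x * regular_op 0 A (\<lambda>_. 1) x)"
      by (simp add: mult_ac)
  qed
  finally show ?thesis by simp
qed

section \<open>Weak coupling asymptotics\<close>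

text \<open>
  By \<open>2 * t * \<bar>D x\<bar> \<le> (D x)\<^sup>2 + t\<^sup>2\<close> on the interval. The parameter \<open>t\<close> is any positive bound of the
  \<open>L\<^sup>2\<close> norm, which may itself vanish.
\<close>

lemma L1_le_L2_on_interval:
  assumes R: "0 < R" and D: "potential_on R D" and t: "0 < t" "sqrt (LINT x|lborel. (D x)\<^sup>2) \<le> t"
  shows "(LINT x|lborel. \<bar>D x\<bar>) \<le> (1/2 + R) * t"
proof -
  obtain C where C: "\<And>x. \<bar>D x\<bar> \<le> C" using potential_on_bounded[OF D] by blast
  have int2: "integrable lborel (\<lambda>x. (D x)\<^sup>2)"
    using potential_on_integrable[OF potential_on_mult[OF D potential_on_measurable[OF D] C]]
    by (simp add: power2_eq_square)
  have intI: "integrable lborel (indicator {-R..R} :: real \<Rightarrow> real)"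
    by (intro integrable_real_indicator) (auto simp: emeasure_lborel_Icc_eq)
  have "(LINT x|lborel. \<bar>D x\<bar>) \<le> (LINT x|lborel. 1 / (2 * t) * (D x)\<^sup>2 + t / 2 * indicator {-R..R} x)"
  proof (rule integral_mono)
    show "integrable lborel (\<lambda>x. \<bar>D x\<bar>)" using potential_on_integrable[OF potential_on_abs[OF D]] .
    show "integrable lborel (\<lambda>x. 1 / (2 * t) * (D x)\<^sup>2 + t / 2 * indicator {-R..R} x)"
      using int2 intI by (intro Bochner_Integration.integrable_add integrable_mult_right)
    show "\<bar>D x\<bar> \<le> 1 / (2 * t) * (D x)\<^sup>2 + t / 2 * indicator {-R..R} x" for x
    proof (cases "\<bar>x\<bar> \<le> R")
      case True
      have "2 * t * \<bar>D x\<bar> \<le> (D x)\<^sup>2 + t\<^sup>2"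
        using zero_le_power2[of "\<bar>D x\<bar> - t"] by (simp add: power2_diff mult_ac)
      then have "\<bar>D x\<bar> \<le> 1 / (2 * t) * (D x)\<^sup>2 + t / 2"
        using t(1) by (simp add: field_simps power2_eq_square)
      then show ?thesis using True by (simp add: indicator_def abs_le_iff)
    next
      case False
      then show ?thesis using potential_on_outside[OF D, of x] t(1) by simp
    qed
  qed
  also have "\<dots> = 1 / (2 * t) * (LINT x|lborel. (D x)\<^sup>2) + t / 2 * (2 * R)"
    using int2 intI R by simp
  also have "(LINT x|lborel. (D x)\<^sup>2) \<le> t\<^sup>2"
    using t by (metis real_sqrt_le_iff real_sqrt_abs abs_of_pos)
  then have "1 / (2 * t) * (LINT x|lborel. (D x)\<^sup>2) \<le> 1 / (2 * t) * t\<^sup>2"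
    using t(1) by (intro mult_left_mono) auto
  then have "1 / (2 * t) * (LINT x|lborel. (D x)\<^sup>2) + t / 2 * (2 * R) \<le> 1 / (2 * t) * t\<^sup>2 + t / 2 * (2 * R)"
    by simp
  also have "\<dots> = (1/2 + R) * t" using t(1) by (simp add: field_simps power2_eq_square)
  finally show ?thesis .
qed

text \<open>
  The smallness conditions of the preceding theorems are collected in one threshold \<open>l0\<close> that depends
  only on \<open>R\<close>, \<open>A\<close> and \<open>B\<close>. It is uniform in \<open>W\<close> because only the \<open>L\<^sup>1\<close> norm and the integral of \<open>W\<close>
  enter those conditions, and both are controlled by \<open>N\<close>. This matters since convergence in \<open>L\<^sup>2\<close> gives
  no bound on the values of the potentials that is uniform along the family.
\<close>

theorem weak_coupling_bound_state:
  assumes R: "0 < R" and A: "potential_on R A" and B: "potential_on R B" and neg: "(LINT x|lborel. A x) < 0"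
  obtains l0 K where "0 < l0"
    "\<And>l W q N. \<lbrakk>0 < l; l \<le> l0; potential_on R W; (LINT x|lborel. \<bar>W x - A x - l * B x\<bar>) \<le> N; N \<le> l0;
        AE x in lebesgue. q x = W x\<rbrakk> \<Longrightarrow>
      \<exists>k>0. eigenvalue (schroedinger (\<lambda>x. l * q x)) (complex_of_real (- k\<^sup>2)) \<and>
        \<bar>k / l + 1/2 * (LINT x|lborel. A x)
          + l * (1/2 * (LINT x|lborel. A x * regular_op 0 A (\<lambda>_. 1) x) + 1/2 * (LINT x|lborel. B x))\<bar>
        \<le> 2 * N + K * l\<^sup>2"
proof -
  \<comment> \<open>Half of the negative integral of \<open>A\<close> is spent on \<open>l * B\<close> and the error \<open>N\<close>, a quarter each; half of
  the rest will absorb the deviation of \<open>w\<close> from \<open>1\<close>.\<close>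
  define c where "c = - (LINT x|lborel. A x) / 4"
  define a where "a = (LINT x|lborel. \<bar>A x\<bar>)"
  define b where "b = (LINT x|lborel. \<bar>B x\<bar>)"
  define M where "M = a + b + 1"
  have c: "0 < c" "(LINT x|lborel. A x) = - 4 * c" using neg by (auto simp: c_def)
  have ab: "0 \<le> a" "0 \<le> b" by (auto simp: a_def b_def)
  have M: "0 < M" "a \<le> M" "b \<le> M" using ab by (auto simp: M_def)
  define l0 where "l0 = Min {1, c, c / M, 1 / (4 * R * M), c / (2 * R * M\<^sup>2)}"
  have l0: "0 < l0" using c M R by (simp add: l0_def)
  have l0_le: "l0 \<le> 1" "l0 \<le> c" "l0 \<le> c / M" "l0 \<le> 1 / (4 * R * M)" "l0 \<le> c / (2 * R * M\<^sup>2)"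
    by (simp_all add: l0_def)
  have le: "l \<le> 1" "l \<le> c" "l * M \<le> c" "2 * l * R * M \<le> 1 / 2" "2 * l * R * M\<^sup>2 \<le> c" if "l \<le> l0" for l
  proof -
    have "l * M \<le> l0 * M" "2 * l * R * M \<le> 2 * l0 * R * M" "2 * l * R * M\<^sup>2 \<le> 2 * l0 * R * M\<^sup>2"
      using that M(1) R by (auto intro!: mult_right_mono)
    moreover have "l0 * M \<le> c" "2 * l0 * R * M \<le> 1 / 2" "2 * l0 * R * M\<^sup>2 \<le> c"
      using l0_le M(1) R by (auto simp: field_simps)
    ultimately show "l \<le> 1" "l \<le> c" "l * M \<le> c" "2 * l * R * M \<le> 1 / 2" "2 * l * R * M\<^sup>2 \<le> c"
      using that l0_le(1,2) by linarith+
  qed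
  show thesis
  proof (rule that[OF l0])
    fix l W q N
    assume l: "0 < l" "l \<le> l0" and W: "potential_on R W"
      and N: "(LINT x|lborel. \<bar>W x - A x - l * B x\<bar>) \<le> N" "N \<le> l0"
      and q: "AE x in lebesgue. q x = W x"
    define D where "D x = W x - A x - l * B x" for x
    have Dpot: "potential_on R D"
      unfolding D_def by (intro potential_on_diff W A B potential_on_scale)
    note pot = W A B Dpot
    note int = pot[THEN potential_on_integrable]
    note int_abs = pot[THEN potential_on_abs, THEN potential_on_integrable]
    have "(LINT x|lborel. \<bar>W x\<bar>) \<le> (LINT x|lborel. \<bar>D x\<bar> + \<bar>A x\<bar> + l * \<bar>B x\<bar>)"
    proof (rule integral_mono)
      show "\<bar>W x\<bar> \<le> \<bar>D x\<bar> + \<bar>A x\<bar> + l * \<bar>B x\<bar>" for x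
      proof -
        have "W x = D x + A x + l * B x" by (simp add: D_def)
        moreover have "\<bar>l * B x\<bar> = l * \<bar>B x\<bar>" using l by (simp add: abs_mult)
        ultimately show ?thesis by linarith
      qed
    qed (use int_abs in auto)
    also have "\<dots> = (LINT x|lborel. \<bar>D x\<bar>) + a + l * b"
      using int_abs by (simp add: a_def b_def)
    also have "\<dots> \<le> 1 + a + 1 * b"
      using N le(1)[OF N(2)] le(1)[OF l(2)] ab by (intro add_mono mult_right_mono) (auto simp: D_def)
    finally have WM: "(LINT x|lborel. \<bar>W x\<bar>) \<le> M" by (simp add: M_def)
    have "(LINT x|lborel. D x) \<le> N"
      using order_trans[OF integral_norm_bound[of lborel D]] N(1)[folded D_def] by fastforce
    moreover have "(LINT x|lborel. D x) = (LINT x|lborel. W x) - (LINT x|lborel. A x) - l * (LINT x|lborel. B x)"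
      unfolding D_def using int by simp
    moreover have "l * (LINT x|lborel. B x) \<le> c"
    proof -
      have "(LINT x|lborel. B x) \<le> b" unfolding b_def using int int_abs by (intro integral_mono) auto
      then have "l * (LINT x|lborel. B x) \<le> l * M" using l M by (intro mult_left_mono) auto
      then show ?thesis using le(3)[OF l(2)] by simp
    qed
    moreover have "N \<le> c" using le(2)[OF N(2)] .
    ultimately have Wneg: "(LINT x|lborel. W x) \<le> - 2 * c" using c by linarith
    have small: "2 * l * R * M \<le> 1" "2 * l * R * M < 1" using le(4)[OF l(2)] by auto
    obtain w k where w: "w \<in> borel_measurable borel" "\<And>x. \<bar>w x - 1\<bar> \<le> 2 * l * R * M"
      and k: "0 < k" "k \<le> l * M" "k = - (l / 2) * (LINT x|lborel. W x * w x)"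
      and eq: "\<And>x. \<bar>x\<bar> \<le> R \<Longrightarrow> w x = 1 + l * regular_op k W w x"
      by (rule bound_state_equation[OF R W M(1) WM c(1) Wneg l(1) small(1) le(5)[OF l(2)]]) (rule that)
    have "eigenvalue (schroedinger (\<lambda>x. l * q x)) (complex_of_real (- k\<^sup>2))"
      using l(1) by (intro bound_state_eigenvalue[OF R W k(1) _ w small(2) k(3) eq q]) auto
    moreover note bound_state_expansion[OF R W A B M(1) WM M(2,3)[unfolded a_def b_def] N(1) l(1) small(1) w k eq]
    ultimately show "\<exists>k>0. eigenvalue (schroedinger (\<lambda>x. l * q x)) (complex_of_real (- k\<^sup>2)) \<and>
        \<bar>k / l + 1/2 * (LINT x|lborel. A x)
          + l * (1/2 * (LINT x|lborel. A x * regular_op 0 A (\<lambda>_. 1) x) + 1/2 * (LINT x|lborel. B x))\<bar>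
        \<le> 2 * N + (2 * R * M\<^sup>2 + 2 * R\<^sup>2 * M ^ 3) * l\<^sup>2"
      using k(1) by blast
  qed
qed

lemma eventually_at_right_0_le:
  assumes "0 < (c::real)"
  shows "\<forall>\<^sub>F l in at_right 0. 0 < l \<and> l \<le> c"
  using assms by (auto simp: eventually_at_right_field intro!: exI[of _ c])

text \<open>
  The bracket \<open>w0 + l * w1 + r l\<close> is negative for small \<open>l\<close>, so the square root of its square is its
  negative. Conversely, the expansion makes \<open>sqrt (- e l)\<close> positive; since the square root of a
  negative number is negative by convention, this forces \<open>- e l\<close> to be positive and hence equal to the
  square of its root.
\<close>

lemma square_root_expansion_iff:
  fixes w0 w1 :: real
  assumes w0: "w0 < 0"
  shows "(\<exists>r. r \<in> o[at_right 0](\<lambda>l. l) \<and> (\<forall>\<^sub>F l in at_right 0. e l = - l\<^sup>2 * (w0 + l * w1 + r l)\<^sup>2))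
    \<longleftrightarrow> (\<exists>r. r \<in> o[at_right 0](\<lambda>l. l\<^sup>2) \<and> (\<forall>\<^sub>F l in at_right 0. sqrt (- e l) = - l * w0 - l\<^sup>2 * w1 + r l))"
    (is "?L \<longleftrightarrow> ?R")
proof -
  \<comment> \<open>Up to this size of \<open>l\<close> a correction \<open>l * w1 + s\<close> with \<open>\<bar>s\<bar> \<le> l\<close> is at most half of \<open>- w0\<close>.\<close>
  define c where "c = - w0 / (2 * (\<bar>w1\<bar> + 1))"
  have c: "0 < c" unfolding c_def using w0 by (intro divide_pos_pos) auto
  have neg: "w0 + l * w1 + s < 0" if "0 < l" "l \<le> c" "\<bar>s\<bar> \<le> l" for l s
  proof -
    have "l * w1 \<le> l * \<bar>w1\<bar>" using that by (intro mult_left_mono) auto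
    moreover have "l * (\<bar>w1\<bar> + 1) \<le> c * (\<bar>w1\<bar> + 1)" using that by (intro mult_right_mono) auto
    moreover have "c * (\<bar>w1\<bar> + 1) = - w0 / 2" by (simp add: c_def field_simps)
    moreover have "l * (\<bar>w1\<bar> + 1) = l * \<bar>w1\<bar> + l" by (simp add: distrib_left)
    ultimately show ?thesis using that w0 by linarith
  qed
  note small = eventually_at_right_0_le[OF c]
  show ?thesis
  proof
    assume ?L
    then obtain r where r: "r \<in> o[at_right 0](\<lambda>l. l)"
      and e: "\<forall>\<^sub>F l in at_right 0. e l = - l\<^sup>2 * (w0 + l * w1 + r l)\<^sup>2" by blast
    have "(\<lambda>l. - l * r l) \<in> o[at_right 0](\<lambda>l. l\<^sup>2)"
    proof (rule landau_o.smallI)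
      fix d :: real assume "0 < d"
      then have "\<forall>\<^sub>F l in at_right 0. norm (r l) \<le> d * norm l" by (rule landau_o.smallD[OF r])
      then show "\<forall>\<^sub>F l in at_right 0. norm (- l * r l) \<le> d * norm (l\<^sup>2)"
      proof eventually_elim
        case (elim l)
        then have "\<bar>l\<bar> * \<bar>r l\<bar> \<le> \<bar>l\<bar> * (d * \<bar>l\<bar>)" by (intro mult_left_mono) auto
        then show ?case by (simp add: abs_mult power2_eq_square mult_ac)
      qed
    qed
    moreover have "\<forall>\<^sub>F l in at_right 0. sqrt (- e l) = - l * w0 - l\<^sup>2 * w1 + - l * r l"
      using e small landau_o.smallD[OF r zero_less_one]
    proof eventually_elim
      case (elim l)
      have "w0 + l * w1 + r l < 0" using elim by (intro neg) auto
      then have "sqrt (- e l) = l * - (w0 + l * w1 + r l)"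
        using elim by (simp add: real_sqrt_mult)
      then show ?case by (simp add: algebra_simps power2_eq_square)
    qed
    ultimately show ?R by (intro exI[of _ "\<lambda>l. - l * r l"] conjI)
  next
    assume ?R
    then obtain r where r: "r \<in> o[at_right 0](\<lambda>l. l\<^sup>2)"
      and e: "\<forall>\<^sub>F l in at_right 0. sqrt (- e l) = - l * w0 - l\<^sup>2 * w1 + r l" by blast
    have "(\<lambda>l. - r l / l) \<in> o[at_right 0](\<lambda>l. l)"
    proof (rule landau_o.smallI)
      fix d :: real assume "0 < d"
      then have "\<forall>\<^sub>F l in at_right 0. norm (r l) \<le> d * norm (l\<^sup>2)" by (rule landau_o.smallD[OF r])
      then show "\<forall>\<^sub>F l in at_right 0. norm (- r l / l) \<le> d * norm l"
        using small by eventually_elim (simp add: field_simps power2_eq_square)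
    qed
    moreover have "\<forall>\<^sub>F l in at_right 0. e l = - l\<^sup>2 * (w0 + l * w1 + - r l / l)\<^sup>2"
      using e small landau_o.smallD[OF r zero_less_one]
    proof eventually_elim
      case (elim l)
      have l: "0 < l" using elim by simp
      have "\<bar>- r l / l\<bar> \<le> l" using elim by (simp add: field_simps power2_eq_square)
      then have "w0 + l * w1 + - r l / l < 0" using elim by (intro neg) auto
      moreover have "- l * (w0 + l * w1 + - r l / l) = - l * w0 - l\<^sup>2 * w1 + r l"
        using l by (simp add: field_simps power2_eq_square)
      then have s: "sqrt (- e l) = - l * (w0 + l * w1 + - r l / l)"
        using elim by (simp only:)
      ultimately have "0 < sqrt (- e l)" using l by (simp add: mult_pos_neg)
      then have "- e l = (sqrt (- e l))\<^sup>2" by simp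
      then show ?case unfolding s by (simp add: power_mult_distrib)
    qed
    ultimately show ?L by (intro exI[of _ "\<lambda>l. - r l / l"] conjI)
  qed
qed

text \<open>
  For a constant family the norm in the hypothesis is \<open>l\<close> times the norm of \<open>V1\<close>, which is \<open>o(l)\<close> only
  if \<open>V1\<close> vanishes almost everywhere. This is why \<open>V1\<close> does not occur in the formula for constant
  families.
\<close>

lemma constant_family_correction_vanishes:
  assumes V1: "V1 \<in> Linf" "compact (ess_support V1)"
    and o: "(\<lambda>l. L2_norm_real (\<lambda>x. Vf l x - V x - l * V1 x)) \<in> o[at_right 0](\<lambda>l. l)"
    and const: "\<forall>l>0. AE x in lebesgue. Vf l x = V x"
  shows "(LINT x|lebesgue. V1 x) = 0"
proof -
  obtain R where R: "ess_support V1 \<subseteq> {-R..R}"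
  proof -
    obtain R where "\<forall>x\<in>ess_support V1. norm x \<le> R"
      using compact_imp_bounded[OF V1(2)] by (auto simp: bounded_iff)
    then have "ess_support V1 \<subseteq> {-R..R}" by (auto simp: abs_le_iff)
    then show thesis by (rule that)
  qed
  obtain B where B: "potential_on R B" "AE x in lebesgue. V1 x = B x"
    using ess_support_representative[OF V1(1) R] .
  note Bm [measurable] = potential_on_measurable[OF B(1)]
  define s where "s = sqrt (LINT x|lborel. (B x)\<^sup>2)"
  have norm: "L2_norm_real (\<lambda>x. Vf l x - V x - l * V1 x) = l * s" if l: "0 < l" for l
  proof -
    have "(LINT x|lebesgue. (Vf l x - V x - l * V1 x)\<^sup>2) = (LINT x|lborel. l\<^sup>2 * (B x)\<^sup>2)"
    proof (rule integral_lebesgue_representative)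
      show "AE x in lebesgue. (Vf l x - V x - l * V1 x)\<^sup>2 = l\<^sup>2 * (B x)\<^sup>2"
        using const[rule_format, OF l] B(2) by eventually_elim (simp add: power_mult_distrib)
    qed measurable
    then show ?thesis using l by (simp add: L2_norm_real_def s_def real_sqrt_mult)
  qed
  have "\<bar>s\<bar> \<le> d" if "0 < d" for d
  proof -
    have "\<forall>\<^sub>F l in at_right (0::real). \<bar>s\<bar> \<le> d"
      using landau_o.smallD[OF o that] eventually_at_right_0_le[OF zero_less_one]
    proof eventually_elim
      case (elim l)
      then have "l * \<bar>s\<bar> \<le> l * d" using norm[of l] by (simp add: abs_mult mult.commute)
      then show ?case using elim by simp
    qed
    then show ?thesis by simp
  qed
  then have "s = 0" by (metis abs_le_zero_iff field_le_epsilon add_0)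
  then have "(LINT x|lborel. (B x)\<^sup>2) = 0" by (simp add: s_def)
  moreover have "integrable lborel (\<lambda>x. (B x)\<^sup>2)"
  proof -
    obtain C where C: "\<And>x. \<bar>B x\<bar> \<le> C" using potential_on_bounded[OF B(1)] by blast
    show ?thesis
      using potential_on_integrable[OF potential_on_mult[OF B(1) Bm C]] by (simp add: power2_eq_square)
  qed
  ultimately have "AE x in lborel. (B x)\<^sup>2 = 0"
    using integral_nonneg_eq_0_iff_AE[of lborel "\<lambda>x. (B x)\<^sup>2"] by simp
  then have "AE x in lebesgue. B x = 0" by (intro AE_completion) simp
  with B(2) have ae: "AE x in lebesgue. V1 x = 0" by eventually_elim simp
  have "(LINT x|lebesgue. V1 x) = (LINT x|(lborel :: real measure). 0 :: real)"
    by (rule integral_lebesgue_representative[OF _ ae]) simp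
  then show ?thesis by simp
qed

theorem corollary2:
  fixes V V1 :: "real \<Rightarrow> real" and Vf :: "real \<Rightarrow> real \<Rightarrow> real"
  assumes "V \<in> Linf" and "compact (ess_support V)"
    and "V1 \<in> Linf" and "compact (ess_support V1)"
    and "\<And>l. l > 0 \<Longrightarrow> Vf l \<in> Linf"
    and "\<And>l. l > 0 \<Longrightarrow> compact (ess_support (Vf l))"
    and "\<exists>a b. \<forall>\<^sub>F l in at_right 0. ess_support (Vf l) \<subseteq> {a..b}"
    and "(\<lambda>l. L2_norm_real (\<lambda>x. Vf l x - V x - l * V1 x)) \<in> o[at_right 0](\<lambda>l. l)"
    and "(LINT x|lebesgue. V x) < 0"
  shows "(\<exists>e. (\<forall>\<^sub>F l in at_right 0.
                 e l < 0 \<and>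
                 eigenvalue (schroedinger (\<lambda>x. l * Vf l x)) (complex_of_real (e l))) \<and>
              eigenvalue_asymp V V1 e \<and>
              ((\<forall>l>0. AE x in lebesgue. Vf l x = V x) \<longrightarrow> sqrt_asymp V e)) \<and>
         ((\<forall>l>0. AE x in lebesgue. Vf l x = V x) \<longrightarrow>
              (\<forall>e. eigenvalue_asymp V V1 e \<longleftrightarrow> sqrt_asymp V e))"
proof -
  have iff: "eigenvalue_asymp V V1 e \<longleftrightarrow> sqrt_asymp V e"
    if const: "\<forall>l>0. AE x in lebesgue. Vf l x = V x" for e
  proof -
    have w1: "omega1 V V1 = 1/4 * double_int V"
      using constant_family_correction_vanishes[OF assms(3,4,8) const] by (simp add: omega1_def)
    have "omega0 V < 0" using assms(9) by (simp add: omega0_def)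
    from square_root_expansion_iff[OF this, of e "omega1 V V1"] show ?thesis
      unfolding eigenvalue_asymp_def sqrt_asymp_def w1 omega0_def by simp
  qed
  obtain a b where ab: "\<forall>\<^sub>F l in at_right 0. ess_support (Vf l) \<subseteq> {a..b}"
    using assms(7) by blast
  obtain Ra Rb where Ra: "\<forall>x\<in>ess_support V. norm x \<le> Ra" and Rb: "\<forall>x\<in>ess_support V1. norm x \<le> Rb"
    using compact_imp_bounded[OF assms(2)] compact_imp_bounded[OF assms(4)] by (auto simp: bounded_iff)
  define R where "R = \<bar>Ra\<bar> + \<bar>Rb\<bar> + \<bar>a\<bar> + \<bar>b\<bar> + 1"
  have R: "0 < R" by (simp add: R_def)
  have supp: "ess_support V \<subseteq> {-R..R}" "ess_support V1 \<subseteq> {-R..R}" "{a..b} \<subseteq> {-R..R}"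
    using Ra Rb by (force simp: R_def)+
  obtain A where A: "potential_on R A" "AE x in lebesgue. V x = A x"
    using ess_support_representative[OF assms(1) supp(1)] .
  obtain B where B: "potential_on R B" "AE x in lebesgue. V1 x = B x"
    using ess_support_representative[OF assms(3) supp(2)] .
  note [measurable] = A(1)[THEN potential_on_measurable] B(1)[THEN potential_on_measurable]
  have intA: "(LINT x|lebesgue. V x) = (LINT x|lborel. A x)"
    by (rule integral_lebesgue_representative[OF _ A(2)]) measurable
  have intB: "(LINT x|lebesgue. V1 x) = (LINT x|lborel. B x)"
    by (rule integral_lebesgue_representative[OF _ B(2)]) measurable
  obtain l0 K where l0: "0 < l0" and bs:
    "\<And>l W q N. \<lbrakk>0 < l; l \<le> l0; potential_on R W; (LINT x|lborel. \<bar>W x - A x - l * B x\<bar>) \<le> N; N \<le> l0;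
        AE x in lebesgue. q x = W x\<rbrakk> \<Longrightarrow>
      \<exists>k>0. eigenvalue (schroedinger (\<lambda>x. l * q x)) (complex_of_real (- k\<^sup>2)) \<and>
        \<bar>k / l + 1/2 * (LINT x|lborel. A x)
          + l * (1/2 * (LINT x|lborel. A x * regular_op 0 A (\<lambda>_. 1) x) + 1/2 * (LINT x|lborel. B x))\<bar>
        \<le> 2 * N + K * l\<^sup>2"
    using weak_coupling_bound_state[OF R A(1) B(1) assms(9)[unfolded intA]] by blast
  \<comment> \<open>This distance in \<open>L\<^sup>1\<close> governs the error term. Stated for the given potentials, it does not
  depend on the choice of representatives.\<close>
  define N where "N l = (LINT x|lebesgue. \<bar>Vf l x - V x - l * V1 x\<bar>)" for l
  have rep: "\<forall>\<^sub>F l in at_right 0. \<exists>W. potential_on R W \<and> (AE x in lebesgue. Vf l x = W x)"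
    using ab eventually_at_right_0_le[OF zero_less_one]
  proof eventually_elim
    case (elim l)
    then have "ess_support (Vf l) \<subseteq> {-R..R}" using supp(3) by blast
    from ess_support_representative[OF assms(5) this] elim show ?case by blast
  qed
  have intN: "N l = (LINT x|lborel. \<bar>W x - A x - l * B x\<bar>)"
    if W: "potential_on R W" "AE x in lebesgue. Vf l x = W x" for l W
    unfolding N_def
  proof (rule integral_lebesgue_representative)
    note [measurable] = potential_on_measurable[OF W(1)]
    show "(\<lambda>x. \<bar>W x - A x - l * B x\<bar>) \<in> borel_measurable borel" by measurable
    show "AE x in lebesgue. \<bar>Vf l x - V x - l * V1 x\<bar> = \<bar>W x - A x - l * B x\<bar>"
      using W(2) A(2) B(2) by eventually_elim simp
  qed
  have No: "\<forall>\<^sub>F l in at_right 0. N l \<le> d * l" if d: "0 < d" for d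
  proof -
    \<comment> \<open>The constant of the comparison of the two norms is \<open>1/2 + R\<close>.\<close>
    define t where "t = d / (1/2 + R)"
    have t: "0 < t" "(1/2 + R) * t = d" using d R by (auto simp: t_def)
    show ?thesis
      using landau_o.smallD[OF assms(8) t(1)] rep eventually_at_right_0_le[OF zero_less_one]
    proof eventually_elim
      case (elim l)
      then obtain W where W: "potential_on R W" "AE x in lebesgue. Vf l x = W x" by blast
      note [measurable] = potential_on_measurable[OF W(1)]
      define D where "D x = W x - A x - l * B x" for x
      have D: "potential_on R D"
        unfolding D_def by (intro potential_on_diff W A B potential_on_scale)
      have "(LINT x|lebesgue. (Vf l x - V x - l * V1 x)\<^sup>2) = (LINT x|lborel. (D x)\<^sup>2)"
      proof (rule integral_lebesgue_representative)
        show "(\<lambda>x. (D x)\<^sup>2) \<in> borel_measurable borel" unfolding D_def by measurable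
        show "AE x in lebesgue. (Vf l x - V x - l * V1 x)\<^sup>2 = (D x)\<^sup>2"
          using W(2) A(2) B(2) by eventually_elim (simp add: D_def)
      qed
      then have "sqrt (LINT x|lborel. (D x)\<^sup>2) \<le> t * l"
        using elim by (simp add: L2_norm_real_def)
      then have "(LINT x|lborel. \<bar>D x\<bar>) \<le> (1/2 + R) * (t * l)"
        using t elim by (intro L1_le_L2_on_interval[OF R D]) auto
      also have "\<dots> = ((1/2 + R) * t) * l" by simp
      finally show ?case unfolding t(2) intN[OF W] D_def .
    qed
  qed
  have dbl: "double_int V = 2 * (LINT x|lborel. A x * regular_op 0 A (\<lambda>_. 1) x)"
    by (rule double_int_representative[OF A])
  define P where "P l k \<longleftrightarrow> 0 < k \<and> eigenvalue (schroedinger (\<lambda>x. l * Vf l x)) (complex_of_real (- k\<^sup>2)) \<and>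
      \<bar>k / l + omega0 V + l * omega1 V V1\<bar> \<le> 2 * N l + K * l\<^sup>2" for l k
  have "\<forall>\<^sub>F l in at_right 0. \<exists>k. P l k"
    using rep No[OF l0] eventually_at_right_0_le[OF zero_less_one] eventually_at_right_0_le[OF l0]
  proof eventually_elim
    case (elim l)
    then obtain W where W: "potential_on R W" "AE x in lebesgue. Vf l x = W x" by blast
    have l: "0 < l" "l \<le> 1" "l \<le> l0" using elim by auto
    have "l0 * l \<le> l0 * 1" using l(2) l0 by (intro mult_left_mono) auto
    then have Nl: "N l \<le> l0" using elim by linarith
    from bs[OF l(1,3) W(1) eq_refl[OF intN[OF W, symmetric]] Nl W(2)]
    show ?case
      unfolding P_def by (simp add: omega0_def omega1_def intA intB dbl)
  qed
  moreover define k where "k l = (SOME k. P l k)" for l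
  ultimately have P: "\<forall>\<^sub>F l in at_right 0. P l (k l)"
    by (auto elim!: eventually_mono simp: k_def intro: someI_ex)
  define e where "e l = - (k l)\<^sup>2" for l
  have ev: "\<forall>\<^sub>F l in at_right 0. e l < 0 \<and>
      eigenvalue (schroedinger (\<lambda>x. l * Vf l x)) (complex_of_real (e l))"
    using P by eventually_elim (simp add: P_def e_def)
  define r where "r l = - (k l / l) - omega0 V - l * omega1 V V1" for l
  have "r \<in> o[at_right 0](\<lambda>l. l)"
  proof (rule landau_o.smallI)
    fix d :: real assume d: "0 < d"
    \<comment> \<open>Half of the allowed error is left for \<open>2 * N l\<close>, the other half for \<open>K * l\<^sup>2\<close>.\<close>
    define c where "c = d / (2 * (\<bar>K\<bar> + 1))"
    have c: "0 < c" "\<bar>K\<bar> * c \<le> d / 2" using d by (auto simp: c_def field_simps)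
    have "0 < d / 4" using d by simp
    from P No[OF this] eventually_at_right_0_le[OF c(1)]
    show "\<forall>\<^sub>F l in at_right 0. norm (r l) \<le> d * norm l"
    proof eventually_elim
      case (elim l)
      have "\<bar>r l\<bar> = \<bar>k l / l + omega0 V + l * omega1 V V1\<bar>" by (simp add: r_def)
      also have "\<dots> \<le> 2 * N l + K * l\<^sup>2" using elim by (simp add: P_def)
      also have "K * l\<^sup>2 \<le> (\<bar>K\<bar> * l) * l" using elim by (simp add: power2_eq_square mult_right_mono)
      also have "\<bar>K\<bar> * l \<le> d / 2"
        using mult_left_mono[of l c "\<bar>K\<bar>"] elim c by simp
      finally show ?case using elim by simp
    qed
  qed
  moreover have "\<forall>\<^sub>F l in at_right 0. e l = - l\<^sup>2 * (omega0 V + l * omega1 V V1 + r l)\<^sup>2"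
    using eventually_at_right_0_le[OF zero_less_one]
    by eventually_elim (simp add: e_def r_def power_divide)
  ultimately have "eigenvalue_asymp V V1 e"
    unfolding eigenvalue_asymp_def by blast
  then show ?thesis using ev iff by blast
qed

end
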